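(* Let $a,b,c,\mu\in\mathbb{C}$ with $c,\,c-\mu\notin\mathbb{Z}_{\le0}$, $\operatorname{Re}\mu>0$, $\operatorname{Re}(c-a)>\operatorname{Re}\mu$ and $\operatorname{Re}(c-b)>\operatorname{Re}\mu$. Then for all real $x<1$ $$\int_{-\infty}^x(1-y)^{a+b-c}\,{}_2F_1(a,b;c;y)\,\frac{(x-y)^{\mu-1}}{\Gamma(\mu)}\,dy=\frac{\Gamma(c-a-\mu)}{\Gamma(c-a)}\,\frac{\Gamma(c-b-\mu)}{\Gamma(c-b)}\,\frac{\Gamma(c)}{\Gamma(c-\mu)}\,(1-x)^{a+b-c+\mu}\,{}_2F_1(a,b;c-\mu;x).$$
   Context: ${}_2F_1(a,b;c;z)$ denotes the Gauss hypergeometric function, defined for $|z|<1$ by $\sum_{k\ge0}\frac{(a)_k(b)_k}{(c)_k\,k!}z^k$ (with $c\notin\mathbb{Z}_{\le0}$) and extended by its one-valued analytic continuation to $\mathbb{C}\setminus[1,\infty)$. *)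

theory Defs
  imports "HOL-Complex_Analysis.Complex_Analysis"
begin

definition hyp2F1_domain :: "complex set" where
  "hyp2F1_domain = - (complex_of_real ` {1..})"

definition is_hyp2F1 :: "complex \<Rightarrow> complex \<Rightarrow> complex \<Rightarrow> (complex \<Rightarrow> complex) \<Rightarrow> bool" where
  "is_hyp2F1 a b c F \<longleftrightarrow>
     F holomorphic_on hyp2F1_domain \<and>
     (\<forall>z. norm z < 1 \<longrightarrow>
        (\<lambda>k. pochhammer a k * pochhammer b k / (pochhammer c k * fact k) * z ^ k) sums F z)"

text \<open>
  The value at \<open>z\<close> of the analytic continuation of the Gauss series to the cut plane.
  It is meaningful for \<open>z\<close> in the cut plane and \<open>c\<close> not a nonpositive integer;
  uniqueness of the continuation is \<open>is_hyp2F1_unique\<close>.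
\<close>
definition hyp2F1 :: "complex \<Rightarrow> complex \<Rightarrow> complex \<Rightarrow> complex \<Rightarrow> complex" where
  "hyp2F1 a b c z = (THE w. \<exists>F. is_hyp2F1 a b c F \<and> w = F z)"

lemma is_hyp2F1_unique:
  assumes F: "is_hyp2F1 a b c F" and G: "is_hyp2F1 a b c G" and z: "z \<in> hyp2F1_domain"
  shows "F z = G z"
proof -
  have op: "open hyp2F1_domain"
    unfolding hyp2F1_domain_def
    by (intro open_Compl closed_slot_right)
  have conn: "connected hyp2F1_domain"
    unfolding hyp2F1_domain_def
    by (intro starlike_imp_connected starlike_slotted_complex_plane_right)
  have sub: "ball 0 1 \<subseteq> hyp2F1_domain"
    by (auto simp: hyp2F1_domain_def)
  have eq: "F u = G u" if "u \<in> ball 0 1" for u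
    using F G that unfolding is_hyp2F1_def by (auto intro: sums_unique2)
  show ?thesis
    using analytic_continuation_open[of "ball 0 1" hyp2F1_domain F G z] op conn sub eq z F G
    by (auto simp: is_hyp2F1_def)
qed

lemma hyp2F1_eqI:
  assumes "is_hyp2F1 a b c F" and "z \<in> hyp2F1_domain"
  shows "hyp2F1 a b c z = F z"
  unfolding hyp2F1_def
  by (rule the_equality) (use assms is_hyp2F1_unique in blast)+

end

theory Submission
  imports Defs
begin

text \<open>
  Put \<open>\<alpha> = c - a\<close> and \<open>\<beta> = c - b\<close>. Euler's transformation absorbs the power of \<open>1 - y\<close> (and, on the
  right, that of \<open>1 - x\<close>), so that the claim becomes
  \<open>\<integral> F(\<alpha>, \<beta>; c; y) (x - y)\<^bsup>\<mu>-1\<^esup> dy = const \<cdot> F(\<alpha> - \<mu>, \<beta> - \<mu>; c - \<mu>; x)\<close> over \<open>y < x\<close>.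

  If \<open>Re c > Re \<beta>\<close>, then \<open>F\<close> is an Euler integral of powers \<open>(1 - t y)\<^bsup>-\<alpha>\<^esup>\<close>, for which the integral
  over \<open>y\<close> is a Beta integral, and Fubini's theorem gives the claim. The contiguous relation
  \<open>F(\<alpha>, \<beta>; c; y) = F(\<alpha>, \<beta>; c + 1; y) + \<alpha>\<beta> / (c (c + 1)) y F(\<alpha> + 1, \<beta> + 1; c + 2; y)\<close> then removes
  the restriction on \<open>c\<close>, both for the existence of the analytic continuation and for the integral,
  by induction and without any estimate of \<open>F\<close> at infinity.
\<close>

subsection \<open>Gamma and Beta integrals\<close>

lemma powr_of_real_pos: "complex_of_real t powr z = exp (z * of_real (ln t))" if "t > 0"
  using that by (simp add: powr_def Ln_of_real)

lemma norm_powr_of_real_pos: "norm (complex_of_real t powr z) = t powr Re z" if "t > 0"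
  using that by (simp add: norm_powr_real_powr)

lemma powr_of_real_mult:
  "complex_of_real (s * t) powr z = complex_of_real s powr z * complex_of_real t powr z"
  if "s > 0" "t > 0"
  using that powr_times_real[of "of_real s" "of_real t" z] by simp

text \<open>Off the positive axis the principal power is still an explicit function of the real
  base: the logarithm of \<open>t < 0\<close> is \<open>ln (- t) + \<i> * pi\<close>, and
  \<open>0 powr z = 0\<close>. So the integrands in Fubini's theorem are jointly measurable although
  bases such as \<open>1 - y * t\<close> change sign.\<close>

lemma borel_measurable_powr_of_real [measurable (raw)]:
  fixes z :: complex
  assumes [measurable]: "f \<in> borel_measurable M"
  shows "(\<lambda>x. complex_of_real (f x) powr z) \<in> borel_measurable M"
proof -
  have "complex_of_real t powr z =
      (if t = 0 then 0
       else exp (z * (if t > 0 then of_real (ln t) else of_real (ln (- t)) + \<i> * of_real pi)))" for t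
    using Ln_minus[of "complex_of_real (- t)"] Ln_of_real[of "- t"]
    by (cases t "0::real" rule: linorder_cases) (auto simp: powr_def Ln_of_real)
  then show ?thesis
    by simp
qed

text \<open>The norm of a product of powers is the same product with real exponents. Its integral is
  thus an instance of the complex formula, which this rule carries back to real-valued
  functions.\<close>

lemma has_bochner_integral_of_real_D:
  "has_bochner_integral M f (Re v)" if "has_bochner_integral M (\<lambda>x. complex_of_real (f x)) v"
  using has_bochner_integral_bounded_linear[OF bounded_linear_Re that] by simp

text \<open>Both inner integrals are given in closed form, so exchanging the order yields a new
  evaluation: \<open>h\<close> inherits the integral that \<open>g\<close> is known to have. The
  hypotheses on \<open>N\<close> are Tonelli's condition for joint integrability.\<close>

lemma has_bochner_integral_Fubini:
  fixes f :: "real \<Rightarrow> real \<Rightarrow> complex"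
  assumes [measurable]: "case_prod f \<in> borel_measurable (lborel \<Otimes>\<^sub>M lborel)"
    and norm: "\<And>x. has_bochner_integral lborel (\<lambda>y. norm (f x y)) (N x)" "integrable lborel N"
    and g: "\<And>x. has_bochner_integral lborel (f x) (g x)"
    and h: "\<And>y. has_bochner_integral lborel (\<lambda>x. f x y) (h y)"
    and v: "has_bochner_integral lborel g v"
  shows "has_bochner_integral lborel h v"
proof -
  have eqs: "(\<lambda>x. \<integral>y. norm (f x y) \<partial>lborel) = N" "(\<lambda>x. \<integral>y. f x y \<partial>lborel) = g"
    "(\<lambda>y. \<integral>x. f x y \<partial>lborel) = h"
    using norm(1) g h by (auto intro!: has_bochner_integral_integral_eq)
  have int: "integrable (lborel \<Otimes>\<^sub>M lborel) (case_prod f)"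
    by (rule lborel_pair.Fubini_integrable)
       (use norm(2) g in \<open>simp_all add: eqs has_bochner_integral_iff\<close>)
  have "integrable lborel h" "integral\<^sup>L lborel h = v"
    using lborel_pair.integrable_snd[OF int] lborel_pair.Fubini_integral[OF int] v
    by (simp_all add: eqs has_bochner_integral_iff)
  then show ?thesis
    by (simp add: has_bochner_integral_iff)
qed

lemma has_bochner_integral_Gamma:
  assumes "Re z > 0" "k > 0"
  shows "has_bochner_integral lborel
    (\<lambda>t. indicator {0<..} t *\<^sub>R (complex_of_real t powr (z - 1) * of_real (exp (- (k * t)))))
    (Gamma z * complex_of_real k powr (- z))"
proof -
  let ?f = "\<lambda>t. indicator {0<..} t *\<^sub>R (complex_of_real t powr (z - 1) / of_real (exp t))"
  have "set_integrable lebesgue {0<..} (\<lambda>t. complex_of_real t powr (z - 1) / of_real (exp t))"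
    using absolutely_integrable_Gamma_integral'[OF assms(1)] .
  then have 1: "integrable lborel ?f"
    unfolding set_integrable_def by (subst (asm) integrable_completion) simp_all
  \<comment> \<open>The value is known only for the gauge integral; uniqueness of that integral
    transfers it to the Lebesgue integral.\<close>
  have "(?f has_integral integral\<^sup>L lborel ?f) UNIV"
    using 1 by (rule has_integral_integral_lborel)
  moreover have "(?f has_integral Gamma z) UNIV"
    using Gamma_integral_complex'[OF assms(1)]
    by (subst (asm) has_integral_restrict_UNIV[symmetric])
       (auto elim!: has_integral_eq[rotated] simp: indicator_def)
  ultimately have "has_bochner_integral lborel ?f (Gamma z)"
    using 1 by (auto simp: has_bochner_integral_iff dest: has_integral_unique)
  then have 2: "has_bochner_integral lborel (\<lambda>x. ?f (0 + k * x)) (Gamma z /\<^sub>R \<bar>k\<bar>)"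
    using assms by (subst (asm) lborel_has_bochner_integral_real_affine_iff[of k _ _ 0]) simp_all
  \<comment> \<open>The factor \<open>k powr (1 - z)\<close> undoes the
    \<open>k powr (z - 1)\<close> produced by the substitution; with the Jacobian
    \<open>1 / k\<close> it leaves \<open>k powr (- z)\<close>.\<close>
  have "?f (0 + k * t) * (complex_of_real k powr (1 - z)) =
      indicator {0<..} t *\<^sub>R (complex_of_real t powr (z - 1) * of_real (exp (- (k * t))))" for t
  proof (cases "t > 0")
    case True
    have "complex_of_real (k * t) powr (z - 1) * complex_of_real k powr (1 - z) =
        complex_of_real t powr (z - 1) * (complex_of_real k powr (z - 1) * complex_of_real k powr (1 - z))"
      using assms True by (simp only: powr_of_real_mult mult_ac)
    also have "complex_of_real k powr (z - 1) * complex_of_real k powr (1 - z) = 1"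
      using assms by (simp flip: powr_add)
    finally show ?thesis
      using assms True by (simp add: exp_minus field_simps zero_less_mult_iff)
  qed (use assms in \<open>simp add: indicator_def zero_less_mult_iff\<close>)
  moreover have "(Gamma z /\<^sub>R \<bar>k\<bar>) * (complex_of_real k powr (1 - z)) =
      Gamma z * complex_of_real k powr (- z)"
    using assms by (simp add: powr_diff powr_minus scaleR_conv_of_real field_simps)
  ultimately show ?thesis
    using has_bochner_integral_mult_left[of "complex_of_real k powr (1 - z)", OF 2] by simp
qed

text \<open>\<open>Gamma q * (1 + u) powr (- q)\<close> is a Gamma integral in a second variable
  \<open>s\<close> with rate \<open>1 + u\<close>. In the other order, the integral over
  \<open>u\<close> is a Gamma integral with rate \<open>s\<close>, and what remains in
  \<open>s\<close> is one with exponent \<open>q - p\<close>.\<close>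

lemma has_bochner_integral_Beta:
  assumes "Re p > 0" "Re p < Re q"
  shows "has_bochner_integral lborel
    (\<lambda>u. indicator {0<..} u *\<^sub>R (complex_of_real u powr (p - 1) * complex_of_real (1 + u) powr (- q)))
    (Gamma p * Gamma (q - p) / Gamma q)"
proof -
  \<comment> \<open>The parameters are arguments of \<open>f\<close> and \<open>g\<close> because
    the norm of \<open>f p q\<close> is the instance at \<open>Re p\<close>,
    \<open>Re q\<close>.\<close>
  define f where "f p q s u = (if s > 0 \<and> u > 0 then
      complex_of_real u powr (p - 1) * complex_of_real s powr (q - 1) * of_real (exp (- ((1 + u) * s)))
      else 0)" for p q s u
  define g where "g p q s = Gamma p * (indicator {0<..} s *\<^sub>R
      (complex_of_real s powr (q - p - 1) * of_real (exp (- (1 * s)))))" for p q s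
  have f_int: "has_bochner_integral lborel (f p q s) (g p q s)" if "Re p > 0" for p q s
  proof (cases "s > 0")
    case True
    have E: "exp (- ((1 + u) * s)) = exp (- s) * exp (- (s * u))" for u
      by (simp add: algebra_simps flip: exp_add)
    have "has_bochner_integral lborel (\<lambda>u. complex_of_real s powr (q - 1) * of_real (exp (- s)) *
       (indicator {0<..} u *\<^sub>R (complex_of_real u powr (p - 1) * of_real (exp (- (s * u))))))
       (complex_of_real s powr (q - 1) * of_real (exp (- s)) * (Gamma p * complex_of_real s powr (- p)))"
      by (intro has_bochner_integral_mult_right has_bochner_integral_Gamma that True)
    also have "(\<lambda>u. complex_of_real s powr (q - 1) * of_real (exp (- s)) *
       (indicator {0<..} u *\<^sub>R (complex_of_real u powr (p - 1) * of_real (exp (- (s * u)))))) = f p q s"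
      using True E by (auto simp: f_def fun_eq_iff)
    also have "complex_of_real s powr (q - 1) * of_real (exp (- s)) * (Gamma p * complex_of_real s powr (- p)) = g p q s"
      using True powr_add[of "complex_of_real s" "q - 1" "- p"] by (simp add: g_def algebra_simps)
    finally show ?thesis .
  next
    case False
    then have "f p q s = (\<lambda>_. 0)" "g p q s = 0"
      by (auto simp: f_def g_def fun_eq_iff)
    then show ?thesis by (simp add: has_bochner_integral_zero)
  qed
  have g_int: "has_bochner_integral lborel (g p q) (Gamma p * Gamma (q - p))" if "Re p < Re q" for p q
    unfolding g_def using has_bochner_integral_Gamma[of "q - p" 1] that
    by (intro has_bochner_integral_mult_right) auto
  have norm_f: "complex_of_real (norm (f p q s u)) = f (Re p) (Re q) s u" for s u
    using norm_powr_of_real_pos powr_of_real[of s "Re q - 1"] powr_of_real[of u "Re p - 1"]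
    by (auto simp: f_def norm_mult)
  let ?h = "\<lambda>u. Gamma q * (indicator {0<..} u *\<^sub>R (complex_of_real u powr (p - 1) * complex_of_real (1 + u) powr (- q)))"
  have h_int: "has_bochner_integral lborel ?h (Gamma p * Gamma (q - p))"
  proof (rule has_bochner_integral_Fubini)
    show "case_prod (f p q) \<in> borel_measurable (lborel \<Otimes>\<^sub>M lborel)"
      unfolding f_def by measurable
    show "has_bochner_integral lborel (f p q s) (g p q s)" for s
      by (rule f_int) fact
    show "has_bochner_integral lborel (\<lambda>u. norm (f p q s u)) (Re (g (Re p) (Re q) s))" for s
      using f_int[of "Re p" "Re q" s] assms by (intro has_bochner_integral_of_real_D) (simp add: norm_f)
    show "integrable lborel (\<lambda>s. Re (g (Re p) (Re q) s))"
      using g_int[of "Re p" "Re q"] assms by (intro integrable_Re) (simp add: has_bochner_integral_iff)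
    show "has_bochner_integral lborel (g p q) (Gamma p * Gamma (q - p))"
      by (rule g_int) fact
    show "has_bochner_integral lborel (\<lambda>s. f p q s u) (?h u)" for u
    proof (cases "u > 0")
      case True
      have "has_bochner_integral lborel (\<lambda>s. complex_of_real u powr (p - 1) *
         (indicator {0<..} s *\<^sub>R (complex_of_real s powr (q - 1) * of_real (exp (- ((1 + u) * s))))))
         (complex_of_real u powr (p - 1) * (Gamma q * complex_of_real (1 + u) powr (- q)))"
        using True assms by (intro has_bochner_integral_mult_right has_bochner_integral_Gamma) auto
      also have "(\<lambda>s. complex_of_real u powr (p - 1) *
         (indicator {0<..} s *\<^sub>R (complex_of_real s powr (q - 1) * of_real (exp (- ((1 + u) * s))))))
         = (\<lambda>s. f p q s u)"
        using True by (auto simp: f_def fun_eq_iff)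
      finally show ?thesis using True by (simp add: mult_ac)
    next
      case False
      then have "(\<lambda>s. f p q s u) = (\<lambda>_. 0)"
        by (auto simp: f_def fun_eq_iff)
      with False show ?thesis by (simp add: has_bochner_integral_zero)
    qed
  qed
  have "Gamma q \<noteq> 0"
    using assms by (auto simp: Gamma_eq_zero_iff elim!: nonpos_Ints_cases)
  then show ?thesis
    using has_bochner_integral_mult_right[of "1 / Gamma q", OF h_int] by simp
qed

subsection \<open>Integrals of powers over the cut plane\<close>

lemma open_hyp2F1_domain: "open hyp2F1_domain"
  unfolding hyp2F1_domain_def by (intro open_Compl closed_slot_right)

lemma of_real_in_hyp2F1_domain: "complex_of_real x \<in> hyp2F1_domain" if "x < 1"
  using that by (auto simp: hyp2F1_domain_def)

text \<open>If \<open>1 - z * s = r\<close> with \<open>r \<le> 0\<close>, then \<open>s > 0\<close>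
  and \<open>z = (1 - r) / s \<ge> 1\<close> lies on the slit. Hence principal powers of
  \<open>1 - z * s\<close> are holomorphic in \<open>z\<close> on the whole cut plane.\<close>

lemma hyp2F1_domain_kernel:
  assumes "z \<in> hyp2F1_domain" "s \<in> {0..1}"
  shows "1 - z * complex_of_real s \<notin> \<real>\<^sub>\<le>\<^sub>0"
proof
  assume "1 - z * complex_of_real s \<in> \<real>\<^sub>\<le>\<^sub>0"
  then obtain r where r: "1 - z * complex_of_real s = of_real r" "r \<le> 0"
    by (auto elim: nonpos_Reals_cases)
  have "s > 0"
    using assms r by (cases "s = 0") auto
  with r have "z = complex_of_real ((1 - r) / s)"
    by (simp add: field_simps)
  moreover have "(1 - r) / s \<ge> 1"
    using r \<open>s > 0\<close> assms(2) by (auto simp: field_simps)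
  ultimately show False
    using assms(1) of_real_eq_iff unfolding hyp2F1_domain_def by blast
qed

lemma continuous_on_hyp2F1_kernel:
  assumes "continuous_on A f" "continuous_on A g"
    and "\<And>x. x \<in> A \<Longrightarrow> f x \<in> hyp2F1_domain" "\<And>x. x \<in> A \<Longrightarrow> g x \<in> {0..1}"
  shows "continuous_on A (\<lambda>x. (1 - f x * complex_of_real (g x)) powr p)"
proof (rule continuous_on_compose2[of "- \<real>\<^sub>\<le>\<^sub>0" "\<lambda>w. w powr p"])
  show "continuous_on (- \<real>\<^sub>\<le>\<^sub>0) (\<lambda>w. w powr p)"
    by (intro holomorphic_on_imp_continuous_on holomorphic_intros) auto
  show "continuous_on A (\<lambda>x. 1 - f x * complex_of_real (g x))"
    by (intro continuous_intros assms(1,2))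
qed (use hyp2F1_domain_kernel assms(3,4) in blast)

lemma hyp2F1_kernel_bound:
  assumes "compact K" "K \<subseteq> hyp2F1_domain"
  obtains C where "\<And>z s. z \<in> K \<Longrightarrow> s \<in> {0..1} \<Longrightarrow> norm ((1 - z * complex_of_real s) powr p) \<le> C"
proof -
  have "continuous_on (K \<times> {0..1}) (\<lambda>(z, s). (1 - z * complex_of_real s) powr p)"
    unfolding case_prod_unfold using assms(2)
    by (intro continuous_on_hyp2F1_kernel continuous_intros) auto
  then have "bounded ((\<lambda>(z, s). (1 - z * complex_of_real s) powr p) ` (K \<times> {0..1}))"
    by (intro compact_imp_bounded compact_continuous_image compact_Times assms(1)) auto
  then obtain C where "\<And>y. y \<in> (\<lambda>(z, s). (1 - z * complex_of_real s) powr p) ` (K \<times> {0..1}) \<Longrightarrow> norm y \<le> C"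
    unfolding bounded_iff by blast
  then have "norm ((1 - z * complex_of_real s) powr p) \<le> C" if "z \<in> K" "s \<in> {0..1}" for z s
    using that by force
  then show ?thesis using that by blast
qed

text \<open>The kernel need not be continuous in \<open>s\<close> outside \<open>{0..1}\<close>, so
  it is cut off there before the composition with \<open>\<tau>\<close>, whose values stay in that
  interval.\<close>

lemma borel_measurable_hyp2F1_kernel:
  assumes [measurable]: "\<tau> \<in> borel_measurable M" and "\<And>u. \<tau> u \<in> {0..1}" "z \<in> hyp2F1_domain"
  shows "(\<lambda>u. (1 - z * complex_of_real (\<tau> u)) powr p) \<in> borel_measurable M"
proof -
  have "(\<lambda>s. indicator {0..1} s *\<^sub>R ((1 - z * complex_of_real s) powr p)) \<in> borel_measurable borel"
    using assms(3)
    by (intro borel_measurable_continuous_on_indicator continuous_on_hyp2F1_kernel continuous_intros) auto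
  from measurable_compose[OF assms(1) this] show ?thesis
    using assms(2) by (simp add: indicator_def)
qed

lemma integrable_hyp2F1_kernel:
  assumes w: "integrable lborel w"
    and \<tau>: "\<tau> \<in> borel_measurable lborel" "\<And>u. \<tau> u \<in> {0..1}" and z: "z \<in> hyp2F1_domain"
  shows "integrable lborel (\<lambda>u. w u * (1 - z * complex_of_real (\<tau> u)) powr p)"
proof -
  note [measurable] = borel_measurable_hyp2F1_kernel[OF \<tau> z] borel_measurable_integrable[OF w]
  obtain C where C: "\<And>x s. x \<in> {z} \<Longrightarrow> s \<in> {0..1} \<Longrightarrow> norm ((1 - x * complex_of_real s) powr p) \<le> C"
    using hyp2F1_kernel_bound[of "{z}" p] z by auto
  show ?thesis
  proof (rule Bochner_Integration.integrable_bound)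
    show "integrable lborel (\<lambda>u. C * norm (w u))"
      using w by auto
    have "norm (w u * (1 - z * complex_of_real (\<tau> u)) powr p) \<le> norm (C * norm (w u))" for u
      using mult_left_mono[OF C[of z "\<tau> u"], of "norm (w u)"] \<tau>(2)[of u]
      by (intro order_trans[OF _ abs_ge_self[of "C * norm (w u)", folded real_norm_def]])
         (simp add: norm_mult mult.commute)
    then show "AE u in lborel. norm (w u * (1 - z * complex_of_real (\<tau> u)) powr p) \<le> norm (C * norm (w u))"
      by auto
  qed measurable
qed

text \<open>Differentiation under the integral sign: near \<open>z0\<close> the difference quotients
  of the kernel are bounded uniformly in \<open>u\<close>, so a constant multiple of
  \<open>norm (w u)\<close> dominates.\<close>

lemma holomorphic_hyp2F1_kernel_integral:
  assumes w: "integrable lborel w"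
    and \<tau>: "\<tau> \<in> borel_measurable lborel" "\<And>u. \<tau> u \<in> {0..1}"
  shows "(\<lambda>z. \<integral>u. w u * (1 - z * complex_of_real (\<tau> u)) powr p \<partial>lborel) holomorphic_on hyp2F1_domain"
    (is "?I holomorphic_on _")
proof (rule holomorphic_onI)
  fix z0 assume z0: "z0 \<in> hyp2F1_domain"
  define k where "k z s = (1 - z * complex_of_real s) powr p" for z s
  define k' where "k' z s = - (p * of_real s) * (1 - z * complex_of_real s) powr (p - 1)" for z s
  obtain r where r: "r > 0" "cball z0 r \<subseteq> hyp2F1_domain"
    using open_hyp2F1_domain z0 open_contains_cball_eq by blast
  obtain C where C: "\<And>z s. z \<in> cball z0 r \<Longrightarrow> s \<in> {0..1} \<Longrightarrow>
      norm ((1 - z * complex_of_real s) powr (p - 1)) \<le> C"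
    using hyp2F1_kernel_bound[OF compact_cball r(2)] by blast
  have deriv: "((\<lambda>z. k z s) has_field_derivative k' z s) (at z within A)"
    if "z \<in> hyp2F1_domain" "s \<in> {0..1}" for z s A
  proof -
    have "((\<lambda>z. 1 - z * complex_of_real s) has_field_derivative - of_real s) (at z within A)"
      by (auto intro!: derivative_eq_intros)
    from DERIV_chain2[OF has_field_derivative_powr[OF hyp2F1_domain_kernel[OF that]] this]
    show ?thesis
      by (simp add: k_def k'_def mult_ac)
  qed
  have k'_le: "norm (k' z s) \<le> norm p * C" if "z \<in> cball z0 r" "s \<in> {0..1}" for z s
  proof -
    have "norm (k' z s) = norm p * (s * norm ((1 - z * complex_of_real s) powr (p - 1)))"
      using that by (simp add: k'_def norm_mult)
    also have "\<dots> \<le> norm p * (1 * C)"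
      using that C[OF that] by (intro mult_left_mono mult_mono) auto
    finally show ?thesis by simp
  qed
  \<comment> \<open>Mean value inequality on the convex disc, where \<open>k'\<close> is
    bounded.\<close>
  have lipschitz: "norm (k z s - k z0 s) \<le> norm p * C * norm (z - z0)"
    if "z \<in> cball z0 r" "s \<in> {0..1}" for z s
    by (rule field_differentiable_bound[of "cball z0 r" _ "\<lambda>z. k' z s"])
       (use that deriv k'_le r in auto)
  have int: "integrable lborel (\<lambda>u. w u * k z (\<tau> u))" if "z \<in> hyp2F1_domain" for z
    unfolding k_def by (rule integrable_hyp2F1_kernel[OF w \<tau> that])
  have [measurable]: "w \<in> borel_measurable lborel" using w by auto
  have [measurable]: "(\<lambda>u. k' z0 (\<tau> u)) \<in> borel_measurable lborel"
    unfolding k'_def using borel_measurable_hyp2F1_kernel[OF \<tau> z0, of "p - 1"] \<tau>(1) by measurable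
  have "((\<lambda>z. (?I z - ?I z0) / (z - z0)) \<longlongrightarrow> (\<integral>u. w u * k' z0 (\<tau> u) \<partial>lborel)) (at z0 within ball z0 r)"
    \<comment> \<open>Dominated convergence concerns sequences, so the limit is tested along every
      sequence in the disc that tends to \<open>z0\<close> and avoids it.\<close>
    unfolding tendsto_at_iff_sequentially
  proof (intro allI impI)
    fix X assume X: "\<forall>i. X i \<in> ball z0 r - {z0}" "X \<longlonglongrightarrow> z0"
    have Xd: "X i \<in> hyp2F1_domain" "X i \<in> cball z0 r" "X i \<noteq> z0" for i
      using X(1) r(2) by (auto simp: subset_iff less_imp_le)
    have "(\<lambda>i. \<integral>u. w u * k (X i) (\<tau> u) / (X i - z0) - w u * k z0 (\<tau> u) / (X i - z0) \<partial>lborel)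
        \<longlonglongrightarrow> (\<integral>u. w u * k' z0 (\<tau> u) \<partial>lborel)"
    proof (rule integral_dominated_convergence[where w = "\<lambda>u. norm p * C * norm (w u)"])
      show "(\<lambda>u. w u * k (X i) (\<tau> u) / (X i - z0) - w u * k z0 (\<tau> u) / (X i - z0)) \<in> borel_measurable lborel" for i
        using int[OF Xd(1)] int[OF z0] by (intro borel_measurable_integrable) auto
      show "AE u in lborel. (\<lambda>i. w u * k (X i) (\<tau> u) / (X i - z0) - w u * k z0 (\<tau> u) / (X i - z0))
          \<longlonglongrightarrow> w u * k' z0 (\<tau> u)"
      proof (rule AE_I2)
        fix u
        have "((\<lambda>z. (k z (\<tau> u) - k z0 (\<tau> u)) / (z - z0)) \<longlongrightarrow> k' z0 (\<tau> u)) (at z0 within ball z0 r)"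
          using deriv[OF z0 \<tau>(2), of u "ball z0 r"] by (simp add: has_field_derivative_iff)
        then have "(\<lambda>i. (k (X i) (\<tau> u) - k z0 (\<tau> u)) / (X i - z0)) \<longlonglongrightarrow> k' z0 (\<tau> u)"
          unfolding tendsto_at_iff_sequentially comp_def using X by blast
        from tendsto_mult_left[OF this, of "w u"]
        show "(\<lambda>i. w u * k (X i) (\<tau> u) / (X i - z0) - w u * k z0 (\<tau> u) / (X i - z0))
          \<longlonglongrightarrow> w u * k' z0 (\<tau> u)"
          by (simp add: diff_divide_distrib right_diff_distrib)
      qed
      have "norm (w u * k (X i) (\<tau> u) / (X i - z0) - w u * k z0 (\<tau> u) / (X i - z0))
          \<le> norm p * C * norm (w u)" for i u
      proof -
        have "norm (w u * k (X i) (\<tau> u) / (X i - z0) - w u * k z0 (\<tau> u) / (X i - z0)) =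
            norm (w u) * (norm (k (X i) (\<tau> u) - k z0 (\<tau> u)) / norm (X i - z0))"
          by (simp add: norm_mult norm_divide flip: diff_divide_distrib right_diff_distrib)
        also have "\<dots> \<le> norm (w u) * (norm p * C)"
          using lipschitz[OF Xd(2) \<tau>(2), of i u] Xd(3)[of i]
          by (intro mult_left_mono) (auto simp: field_simps)
        finally show ?thesis by (simp add: mult_ac)
      qed
      then show "AE u in lborel. norm (w u * k (X i) (\<tau> u) / (X i - z0) - w u * k z0 (\<tau> u) / (X i - z0))
          \<le> norm p * C * norm (w u)" for i
        by auto
    qed (use w in auto)
    also have "(\<lambda>i. \<integral>u. w u * k (X i) (\<tau> u) / (X i - z0) - w u * k z0 (\<tau> u) / (X i - z0) \<partial>lborel) =
        (\<lambda>i. (?I (X i) - ?I z0) / (X i - z0))"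
      using int[OF Xd(1)] int[OF z0]
      by (subst Bochner_Integration.integral_diff) (auto simp: k_def fun_eq_iff diff_divide_distrib)
    finally show "((\<lambda>z. (?I z - ?I z0) / (z - z0)) \<circ> X) \<longlonglongrightarrow> (\<integral>u. w u * k' z0 (\<tau> u) \<partial>lborel)"
      by (simp add: comp_def)
  qed
  then have "(?I has_field_derivative (\<integral>u. w u * k' z0 (\<tau> u) \<partial>lborel)) (at z0 within ball z0 r)"
    by (simp add: has_field_derivative_iff)
  then have "(?I has_field_derivative (\<integral>u. w u * k' z0 (\<tau> u) \<partial>lborel)) (at z0)"
    using r(1) by (subst (asm) at_within_open) auto
  then show "?I field_differentiable at z0 within hyp2F1_domain"
    using field_differentiable_at_within field_differentiable_def by blast
qed

subsection \<open>Existence of the continuation\<close>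

lemma binomial_series_pochhammer:
  fixes a w :: complex
  assumes "norm w < 1"
  shows "(\<lambda>k. pochhammer a k / fact k * w ^ k) sums (1 - w) powr (- a)"
proof -
  have "(- a gchoose k) * (- w) ^ k = pochhammer a k / fact k * w ^ k" for k
  proof -
    have "(- a gchoose k) * (- w) ^ k = pochhammer a k / fact k * ((- 1) ^ k * (- w) ^ k)"
      by (simp add: gbinomial_pochhammer)
    also have "(- 1) ^ k * (- w) ^ k = w ^ k"
      by (subst power_mult_distrib[symmetric]) simp
    finally show ?thesis .
  qed
  then show ?thesis
    using gen_binomial_complex[of "- w" "- a"] assms by simp
qed

text \<open>Under \<open>t = u / (1 + u)\<close>, Euler's density
  \<open>t powr (b - 1) * (1 - t) powr (c - b - 1)\<close> times the Jacobian
  \<open>(1 + u) powr (- 2)\<close> becomes this weight: the exponents of \<open>1 + u\<close> add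
  up to \<open>- c\<close>. Its total mass is the Beta integral above.\<close>

definition euler_weight :: "complex \<Rightarrow> complex \<Rightarrow> real \<Rightarrow> complex" where
  "euler_weight b c u =
     indicator {0<..} u *\<^sub>R (complex_of_real u powr (b - 1) * complex_of_real (1 + u) powr (- c))"

text \<open>The value 0 off the half-line keeps the range in \<open>{0..1}\<close> for every
  \<open>u\<close>, as the kernel lemmas demand; the weight vanishes there.\<close>

definition euler_ratio :: "real \<Rightarrow> real" where
  "euler_ratio u = (if u > 0 then u / (1 + u) else 0)"

text \<open>
  Euler's integral over \<open>[0, 1]\<close> after the substitution \<open>t = u / (1 + u)\<close>.
\<close>
definition euler_integral :: "complex \<Rightarrow> complex \<Rightarrow> complex \<Rightarrow> complex \<Rightarrow> complex" where
  "euler_integral a b c z = Gamma c / (Gamma b * Gamma (c - b)) *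
     (\<integral>u. euler_weight b c u * (1 - z * complex_of_real (euler_ratio u)) powr (- a) \<partial>lborel)"

lemma euler_ratio_measurable [measurable]: "euler_ratio \<in> borel_measurable borel"
  unfolding euler_ratio_def by measurable

lemma euler_ratio_range: "euler_ratio u \<in> {0..1}"
  by (auto simp: euler_ratio_def field_simps)

lemma has_bochner_integral_euler_weight:
  assumes "Re b > 0" "Re c > Re b"
  shows "has_bochner_integral lborel (euler_weight b c) (Gamma b * Gamma (c - b) / Gamma c)"
  unfolding euler_weight_def by (rule has_bochner_integral_Beta) (use assms in auto)

text \<open>With \<open>t = u / (1 + u)\<close> one has
  \<open>t powr p = u powr p * (1 + u) powr (- p)\<close>, so a power of \<open>t\<close> only
  shifts both parameters of the weight. Natural \<open>p\<close> occur in termwise integration,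
  \<open>p = - \<mu>\<close> in the fractional integral.\<close>

lemma euler_weight_mult_ratio_powr:
  assumes "u > 0"
  shows "euler_weight b c u * complex_of_real (euler_ratio u) powr p = euler_weight (b + p) (c + p) u"
proof -
  have "complex_of_real (euler_ratio u) powr p =
      complex_of_real u powr p * complex_of_real (1 + u) powr (- p)"
    using assms powr_of_real_mult[of u "inverse (1 + u)" p] powr_of_real_pos[of "1 + u"]
      powr_of_real_pos[of "inverse (1 + u)"]
    by (simp add: euler_ratio_def divide_inverse ln_inverse)
  moreover have "complex_of_real u powr (b + p - 1) = complex_of_real u powr (b - 1) * complex_of_real u powr p"
    by (simp add: algebra_simps flip: powr_add)
  moreover have "complex_of_real (1 + u) powr (- (c + p)) = complex_of_real (1 + u) powr (- c) * complex_of_real (1 + u) powr (- p)"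
    by (simp add: algebra_simps flip: powr_add)
  ultimately show ?thesis
    using assms by (simp add: euler_weight_def mult_ac)
qed

lemma euler_weight_mult_ratio_power:
  "euler_weight b c u * complex_of_real (euler_ratio u) ^ k = euler_weight (b + of_nat k) (c + of_nat k) u"
proof (cases "u > 0")
  case True
  then have "euler_ratio u \<noteq> 0"
    by (auto simp: euler_ratio_def)
  then show ?thesis
    using euler_weight_mult_ratio_powr[OF True, of b c "of_nat k"] by simp
qed (simp add: euler_weight_def)

lemma not_nonpos_Ints_Re_pos: "z \<notin> \<int>\<^sub>\<le>\<^sub>0" if "Re z > 0"
  using that by (auto elim!: nonpos_Ints_cases)

text \<open>Expand the kernel in its binomial series and integrate term by term. The term of index
  \<open>k\<close> is a Beta integral with parameters shifted by \<open>k\<close>, and the resulting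
  Gamma quotients are \<open>pochhammer b k / pochhammer c k\<close>.\<close>

lemma euler_integral_sums:
  assumes "Re b > 0" "Re c > Re b" "norm z < 1"
  shows "(\<lambda>k. pochhammer a k * pochhammer b k / (pochhammer c k * fact k) * z ^ k) sums euler_integral a b c z"
proof -
  define K where "K = Gamma c / (Gamma b * Gamma (c - b))"
  define t where "t k = pochhammer a k / fact k * z ^ k" for k
  define f where "f k u = t k * euler_weight (b + of_nat k) (c + of_nat k) u" for k u
  have w: "integrable lborel (euler_weight b c)"
    using has_bochner_integral_euler_weight[OF assms(1,2)] by (simp add: has_bochner_integral_iff)
  have f_int: "has_bochner_integral lborel (f k)
      (t k * (Gamma (b + of_nat k) * Gamma (c - b) / Gamma (c + of_nat k)))" for k
    unfolding f_def using has_bochner_integral_euler_weight[of "b + of_nat k" "c + of_nat k"] assms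
    by (intro has_bochner_integral_mult_right) auto
  have f_eq: "f k u = euler_weight b c u * (pochhammer a k / fact k * (z * complex_of_real (euler_ratio u)) ^ k)" for k u
    by (simp add: f_def t_def power_mult_distrib flip: euler_weight_mult_ratio_power)
  \<comment> \<open>A power series convergent at some \<open>r > norm z\<close> converges absolutely
    at \<open>z\<close>.\<close>
  have sm: "summable (\<lambda>k. norm (t k))"
  proof -
    obtain r where r: "norm z < r" "r < 1" using dense assms(3) by blast
    have "summable (\<lambda>k. pochhammer a k / fact k * complex_of_real r ^ k)"
      using r le_less_trans[OF norm_ge_zero r(1)] 
      by (intro sums_summable[OF binomial_series_pochhammer]) auto
    from powser_insidea[OF this, of z] show ?thesis
      using r le_less_trans[OF norm_ge_zero r(1)] by (simp add: t_def)
  qed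
  have norm_f: "norm (f k u) \<le> norm (t k) * norm (euler_weight b c u)" for k u
  proof -
    have "norm (f k u) = norm (t k) * norm (euler_weight b c u) * (euler_ratio u ^ k)"
      using euler_ratio_range[of u] by (simp add: f_eq t_def power_mult_distrib norm_mult norm_power norm_divide)
    also have "\<dots> \<le> norm (t k) * norm (euler_weight b c u) * 1"
      using euler_ratio_range[of u] by (intro mult_left_mono power_le_one) auto
    finally show ?thesis by simp
  qed
  have "(\<lambda>k. integral\<^sup>L lborel (f k)) sums (\<integral>u. (\<Sum>k. f k u) \<partial>lborel)"
  proof (rule sums_integral)
    show "integrable lborel (f k)" for k
      using f_int[of k] by (simp add: has_bochner_integral_iff)
    show "AE u in lborel. summable (\<lambda>k. norm (f k u))"
      using norm_f by (intro AE_I2 summable_comparison_test'[OF summable_mult2[OF sm]]) auto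
    show "summable (\<lambda>k. \<integral>u. norm (f k u) \<partial>lborel)"
    proof (rule summable_comparison_test'[OF summable_mult2[OF sm]])
      fix k
      have "(\<integral>u. norm (f k u) \<partial>lborel) \<le> (\<integral>u. norm (t k) * norm (euler_weight b c u) \<partial>lborel)"
        using norm_f w f_int[of k] by (intro integral_mono) (auto simp: has_bochner_integral_iff)
      then show "norm (\<integral>u. norm (f k u) \<partial>lborel) \<le> norm (t k) * (\<integral>u. norm (euler_weight b c u) \<partial>lborel)"
        by simp
    qed
  qed
  also have "(\<lambda>u. \<Sum>k. f k u) = (\<lambda>u. euler_weight b c u * (1 - z * complex_of_real (euler_ratio u)) powr (- a))"
  proof
    fix u
    have "norm (z * complex_of_real (euler_ratio u)) < 1"
      using euler_ratio_range[of u] assms(3) mult_left_mono[of "euler_ratio u" 1 "norm z"]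
      by (simp add: norm_mult)
    from sums_mult[OF binomial_series_pochhammer[OF this], of "euler_weight b c u" a]
    show "(\<Sum>k. f k u) = euler_weight b c u * (1 - z * complex_of_real (euler_ratio u)) powr (- a)"
      unfolding f_eq by (simp add: sums_iff)
  qed
  finally have "(\<lambda>k. K * integral\<^sup>L lborel (f k)) sums euler_integral a b c z"
    unfolding euler_integral_def K_def by (rule sums_mult)
  moreover have "K * integral\<^sup>L lborel (f k) =
      pochhammer a k * pochhammer b k / (pochhammer c k * fact k) * z ^ k" for k
  proof -
    have nz: "b \<notin> \<int>\<^sub>\<le>\<^sub>0" "c \<notin> \<int>\<^sub>\<le>\<^sub>0" "c - b \<notin> \<int>\<^sub>\<le>\<^sub>0" "c + of_nat k \<notin> \<int>\<^sub>\<le>\<^sub>0"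
      using assms by (auto intro!: not_nonpos_Ints_Re_pos)
    then have "Gamma b \<noteq> 0" "Gamma c \<noteq> 0" "Gamma (c - b) \<noteq> 0" "Gamma (c + of_nat k) \<noteq> 0"
      by (simp_all add: Gamma_eq_zero_iff)
    then show ?thesis
      using nz by (simp add: has_bochner_integral_integral_eq[OF f_int] K_def t_def pochhammer_Gamma mult_ac)
  qed
  ultimately show ?thesis by simp
qed

lemma is_hyp2F1_euler_integral:
  assumes "Re b > 0" "Re c > Re b"
  shows "is_hyp2F1 a b c (euler_integral a b c)"
  unfolding is_hyp2F1_def
proof (intro conjI allI impI)
  have "integrable lborel (euler_weight b c)"
    using has_bochner_integral_euler_weight[OF assms] by (simp add: has_bochner_integral_iff)
  then show "euler_integral a b c holomorphic_on hyp2F1_domain"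
    unfolding euler_integral_def using euler_ratio_range
    by (intro holomorphic_intros holomorphic_hyp2F1_kernel_integral) auto
qed (rule euler_integral_sums[OF assms])

text \<open>Compare coefficients. If \<open>T\<close> is the term of index \<open>k\<close> for the
  lower parameter \<open>c\<close>, the first series contributes \<open>c / (c + k) * T\<close> and
  the second, shifted by its factor \<open>z\<close>, contributes
  \<open>k / (c + k) * T\<close>.\<close>

lemma is_hyp2F1_contiguous:
  assumes F: "is_hyp2F1 a b (c + 1) F" and G: "is_hyp2F1 (a + 1) (b + 1) (c + 2) G"
    and c: "c \<notin> \<int>\<^sub>\<le>\<^sub>0"
  shows "is_hyp2F1 a b c (\<lambda>z. F z + a * b / (c * (c + 1)) * z * G z)"
  unfolding is_hyp2F1_def
proof (intro conjI allI impI)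
  show "(\<lambda>z. F z + a * b / (c * (c + 1)) * z * G z) holomorphic_on hyp2F1_domain"
    using F G unfolding is_hyp2F1_def by (intro holomorphic_intros) auto
  have c_nz: "c + of_nat k \<noteq> 0" for k
    using c plus_of_nat_eq_0_imp by blast
  fix z :: complex assume z: "norm z < 1"
  define g where "g k = a * b / (c * (c + 1)) * z * (pochhammer (a + 1) k * pochhammer (b + 1) k / (pochhammer (c + 2) k * fact k) * z ^ k)" for k
  \<comment> \<open>The extra factor \<open>z\<close> moves \<open>g\<close> up by one index, so
    \<open>h\<close> has no constant term.\<close>
  define h where "h k = (if k = 0 then 0 else g (k - 1))" for k
  have "g sums (a * b / (c * (c + 1)) * z * G z)"
    unfolding g_def using G z by (intro sums_mult) (auto simp: is_hyp2F1_def)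
  then have "(\<lambda>k. h (Suc k)) sums (a * b / (c * (c + 1)) * z * G z)"
    by (simp add: h_def)
  then have "h sums (a * b / (c * (c + 1)) * z * G z)"
    by (subst (asm) sums_Suc_iff) (simp add: h_def)
  then have sums: "(\<lambda>k. pochhammer a k * pochhammer b k / (pochhammer (c + 1) k * fact k) * z ^ k + h k)
      sums (F z + a * b / (c * (c + 1)) * z * G z)"
    using F z by (intro sums_add) (auto simp: is_hyp2F1_def)
  have "pochhammer a k * pochhammer b k / (pochhammer (c + 1) k * fact k) * z ^ k + h k =
      pochhammer a k * pochhammer b k / (pochhammer c k * fact k) * z ^ k" for k
  proof -
    have pc: "pochhammer c k \<noteq> 0" "pochhammer c (Suc k) \<noteq> 0"
      using c by (auto simp: pochhammer_eq_0_iff)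
    have "pochhammer c k * (c + of_nat k) = c * pochhammer (c + 1) k"
      using pochhammer_rec[of c k] pochhammer_rec'[of c k] by (simp add: mult_ac)
    then have p1: "pochhammer (c + 1) k = pochhammer c k * (c + of_nat k) / c"
      using c_nz[of 0] by (simp add: field_simps)
    have "h k = of_nat k / (c + of_nat k) * (pochhammer a k * pochhammer b k / (pochhammer c k * fact k) * z ^ k)"
    proof (cases k)
      case (Suc m)
      have "pochhammer c (Suc m) * (c + of_nat (Suc m)) = c * ((c + 1) * pochhammer (c + 2) m)"
        using pochhammer_rec[of c "Suc m"] pochhammer_rec'[of c "Suc m"] pochhammer_rec[of "c + 1" m]
        by (simp add: mult_ac add_ac)
      then have p2: "pochhammer (c + 2) m = pochhammer c (Suc m) * (c + of_nat (Suc m)) / (c * (c + 1))"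
        using c_nz[of 0] c_nz[of 1] by (simp add: eq_divide_eq mult_ac)
      show ?thesis
        using pc c_nz[of 0] c_nz[of 1, unfolded of_nat_1] c_nz[of k] unfolding Suc
        by (simp add: h_def g_def p2 pochhammer_rec[of a] pochhammer_rec[of b] divide_simps
            del: of_nat_Suc)
    qed (simp add: h_def)
    then show ?thesis
      using pc c_nz[of 0] c_nz[of k] unfolding p1 by (simp add: divide_simps) (simp add: algebra_simps)
  qed
  with sums show "(\<lambda>k. pochhammer a k * pochhammer b k / (pochhammer c k * fact k) * z ^ k)
      sums (F z + a * b / (c * (c + 1)) * z * G z)"
    by simp
qed

lemma not_nonpos_Ints_plus1: "z + 1 \<notin> \<int>\<^sub>\<le>\<^sub>0" if "z \<notin> \<int>\<^sub>\<le>\<^sub>0" for z :: complex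
  using that plus_one_in_nonpos_Ints_imp by blast

text \<open>Both functions on the right of the contiguous relation have \<open>Re c - Re b\<close>
  larger by 1 and keep \<open>Re b > 0\<close>, so finitely many applications lead to Euler's
  integral. The inner claim quantifies over \<open>a\<close>, \<open>b\<close>, \<open>c\<close>
  because the second function shifts all of them.\<close>

lemma ex_is_hyp2F1:
  assumes "Re b > 0" "c \<notin> \<int>\<^sub>\<le>\<^sub>0"
  shows "\<exists>F. is_hyp2F1 a b c F"
proof -
  have "\<exists>F. is_hyp2F1 a b c F"
    if "Re b > 0" "c \<notin> \<int>\<^sub>\<le>\<^sub>0" "Re c + real n > Re b" for n a b c
    using that
  proof (induction n arbitrary: a b c)
    case 0
    then show ?case using is_hyp2F1_euler_integral by auto
  next
    case (Suc n)
    have c: "c + 1 \<notin> \<int>\<^sub>\<le>\<^sub>0" "c + 2 \<notin> \<int>\<^sub>\<le>\<^sub>0"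
      using not_nonpos_Ints_plus1[OF Suc.prems(2)] not_nonpos_Ints_plus1[of "c + 1"]
      by (simp_all add: add.assoc)
    obtain F G where "is_hyp2F1 a b (c + 1) F" "is_hyp2F1 (a + 1) (b + 1) (c + 2) G"
      using Suc.IH[of b "c + 1" a] Suc.IH[of "b + 1" "c + 2" "a + 1"] Suc.prems c by auto
    from is_hyp2F1_contiguous[OF this Suc.prems(2)] show ?case by blast
  qed
  moreover obtain n where "Re b - Re c < real n"
    using reals_Archimedean2 by blast
  ultimately show ?thesis
    using assms by (simp add: algebra_simps)
qed

text \<open>By uniqueness the definite description returns the values of any continuation that
  exists; from here on \<open>hyp2F1\<close> itself serves as the continuation.\<close>

lemma is_hyp2F1_hyp2F1:
  assumes "Re b > 0" "c \<notin> \<int>\<^sub>\<le>\<^sub>0"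
  shows "is_hyp2F1 a b c (hyp2F1 a b c)"
proof -
  obtain F where F: "is_hyp2F1 a b c F" using ex_is_hyp2F1[OF assms] by blast
  have eq: "hyp2F1 a b c z = F z" if "z \<in> hyp2F1_domain" for z
    using hyp2F1_eqI[OF F that] .
  have "z \<in> hyp2F1_domain" if "norm z < 1" for z
    using that by (auto simp: hyp2F1_domain_def)
  then show ?thesis
    using F eq unfolding is_hyp2F1_def by (auto cong: holomorphic_cong)
qed

lemma hyp2F1_contiguous:
  assumes "Re b > 0" "c \<notin> \<int>\<^sub>\<le>\<^sub>0" "z \<in> hyp2F1_domain"
  shows "hyp2F1 a b c z = hyp2F1 a b (c + 1) z
    + a * b / (c * (c + 1)) * z * hyp2F1 (a + 1) (b + 1) (c + 2) z"
proof -
  have c: "c + 1 \<notin> \<int>\<^sub>\<le>\<^sub>0" "c + 2 \<notin> \<int>\<^sub>\<le>\<^sub>0"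
    using not_nonpos_Ints_plus1[OF assms(2)] not_nonpos_Ints_plus1[of "c + 1"]
    by (simp_all add: add.assoc)
  then show ?thesis
    using assms by (intro hyp2F1_eqI is_hyp2F1_contiguous is_hyp2F1_hyp2F1) auto
qed

subsection \<open>Euler's transformation\<close>

definition hypergeom_fps :: "complex \<Rightarrow> complex \<Rightarrow> complex \<Rightarrow> complex fps" where
  "hypergeom_fps a b c = Abs_fps (\<lambda>k. pochhammer a k * pochhammer b k / (pochhammer c k * fact k))"

text \<open>Gauss's hypergeometric differential operator. The constants stay separate
  \<open>fps_const\<close> terms so that the purely algebraic
  \<open>euler_transform_identity\<close> applies to it.\<close>

definition hypergeom_ode :: "complex \<Rightarrow> complex \<Rightarrow> complex \<Rightarrow> complex fps \<Rightarrow> complex fps" where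
  "hypergeom_ode a b c y = fps_X * (1 - fps_X) * fps_deriv (fps_deriv y)
     + (fps_const c - (fps_const a + fps_const b + 1) * fps_X) * fps_deriv y
     - fps_const a * fps_const b * y"

text \<open>Reduces the differential equation to a two-term recurrence, which gives both that the
  hypergeometric series solves it and that the solution is determined by its constant term.\<close>

lemma hypergeom_ode_nth:
  "fps_nth (hypergeom_ode a b c y) n = of_nat (Suc n) * (c + of_nat n) * fps_nth y (Suc n)
     - (a + of_nat n) * (b + of_nat n) * fps_nth y n"
proof -
  have eq: "hypergeom_ode a b c y =
      fps_X * fps_deriv (fps_deriv y) - fps_X * (fps_X * fps_deriv (fps_deriv y))
      + fps_const c * fps_deriv y - fps_const (a + b + 1) * (fps_X * fps_deriv y)
      - fps_const (a * b) * y"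
    by (simp add: hypergeom_ode_def algebra_simps flip: fps_const_add)
  show ?thesis
  proof (cases n)
    case (Suc m)
    then show ?thesis
      by (cases m) (simp_all add: eq algebra_simps)
  qed (simp add: eq)
qed

lemma hypergeom_fps_unique:
  assumes "c \<notin> \<int>\<^sub>\<le>\<^sub>0" and "hypergeom_ode a b c y = 0" and "fps_nth y 0 = 1"
  shows "y = hypergeom_fps a b c"
proof (rule fps_ext)
  fix n show "fps_nth y n = fps_nth (hypergeom_fps a b c) n"
  proof (induction n)
    case (Suc n)
    have nz: "c + of_nat n \<noteq> 0" "pochhammer c n \<noteq> 0"
      using assms(1) plus_of_nat_eq_0_imp by (auto simp: pochhammer_eq_0_iff)
    have "of_nat (Suc n) * (c + of_nat n) * fps_nth y (Suc n) = (a + of_nat n) * (b + of_nat n) * fps_nth y n"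
      using hypergeom_ode_nth[of a b c y n] assms(2) by simp
    then have "fps_nth y (Suc n) = (a + of_nat n) * (b + of_nat n) * fps_nth y n / (of_nat (Suc n) * (c + of_nat n))"
      using nz by (simp add: eq_divide_eq mult_ac del: of_nat_Suc)
    then show ?case
      using nz unfolding Suc by (simp add: hypergeom_fps_def pochhammer_Suc mult_ac)
  qed (simp add: assms(3) hypergeom_fps_def)
qed

lemma hypergeom_ode_hypergeom_fps:
  assumes "c \<notin> \<int>\<^sub>\<le>\<^sub>0"
  shows "hypergeom_ode a b c (hypergeom_fps a b c) = 0"
proof (rule fps_ext)
  fix n
  have nz: "c + of_nat n \<noteq> 0" "pochhammer c n \<noteq> 0"
    using assms plus_of_nat_eq_0_imp by (auto simp: pochhammer_eq_0_iff)
  then show "fps_nth (hypergeom_ode a b c (hypergeom_fps a b c)) n = fps_nth 0 n"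
    by (simp add: hypergeom_ode_nth hypergeom_fps_def pochhammer_Suc divide_simps del: of_nat_Suc)
qed

text \<open>Here \<open>y0\<close>, \<open>y1\<close>, \<open>y2\<close> stand for
  \<open>1 - X\<close> to the power \<open>C - A - B\<close> and its two derivatives, and
  \<open>h0\<close>, \<open>h1\<close>, \<open>h2\<close> for a solution of the equation with
  \<open>C - A\<close>, \<open>C - B\<close> and its derivatives. The extra factor
  \<open>1 - X\<close> in the conclusion lets \<open>y1\<close> and \<open>y2\<close> be eliminated
  without division.\<close>

lemma euler_transform_identity:
  fixes A B C X y0 y1 y2 h0 h1 h2 :: "'a :: comm_ring_1"
  assumes 1: "(1 - X) * y1 = - (C - A - B) * y0"
    and 2: "(1 - X) * y2 = (1 - (C - A - B)) * y1"
    and 3: "X * (1 - X) * h2 + (C - (C - A + (C - B) + 1) * X) * h1 - (C - A) * (C - B) * h0 = 0"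
  shows "(1 - X) * (X * (1 - X) * (y2 * h0 + 2 * y1 * h1 + y0 * h2)
    + (C - (A + B + 1) * X) * (y1 * h0 + y0 * h1) - A * B * (y0 * h0)) = 0"
proof -
  define L where "L = 1 - X"
  define S where "S = C - A - B"
  define M where "M = C - (A + B + 1) * X"
  define N where "N = C - (C - A + (C - B) + 1) * X"
  define R where "R = (C - A) * (C - B)"
  have e1: "L * y1 = - S * y0"
    using 1 by (simp only: L_def S_def)
  have e2: "L * (L * y2) = - (1 - S) * S * y0"
  proof -
    have "L * (L * y2) = (1 - S) * (L * y1)"
      using 2 by (simp add: L_def S_def mult_ac)
    then show ?thesis by (simp add: e1 algebra_simps)
  qed
  have e3: "X * L * h2 = R * h0 - N * h1"
    using 3 unfolding L_def[symmetric] N_def[symmetric] R_def[symmetric] by (simp add: algebra_simps)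
  have "L * (X * L * (y2 * h0 + 2 * y1 * h1 + y0 * h2) + M * (y1 * h0 + y0 * h1) - A * B * (y0 * h0)) =
      X * h0 * (L * (L * y2)) + 2 * X * h1 * L * (L * y1) + L * y0 * (X * L * h2)
      + M * h0 * (L * y1) + L * M * y0 * h1 - A * B * L * y0 * h0"
    by (simp add: algebra_simps)
  \<comment> \<open>After the elimination only \<open>y0 * h0\<close> and \<open>y0 * h1\<close>
    remain, and both coefficients vanish identically.\<close>
  also have "\<dots> = y0 * h0 * (L * R - L * (A * B) - M * S - X * (1 - S) * S) + y0 * h1 * L * (M - N - 2 * X * S)"
    unfolding e1 e2 e3 by (simp add: algebra_simps)
  also have "M - N - 2 * X * S = 0"
    by (simp add: M_def N_def S_def algebra_simps)
  also have "L * R - L * (A * B) - M * S - X * (1 - S) * S = 0"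
    by (simp add: L_def R_def M_def S_def algebra_simps)
  finally show ?thesis
    by (simp add: L_def M_def)
qed

text \<open>The product solves the hypergeometric equation with parameters \<open>a\<close>,
  \<open>b\<close>, \<open>c\<close> and has constant term 1, and such a solution is unique. The
  first factor is the binomial series of exponent \<open>c - a - b\<close>.\<close>

lemma hypergeom_fps_euler_transform:
  assumes "c \<notin> \<int>\<^sub>\<le>\<^sub>0"
  shows "Abs_fps (\<lambda>k. pochhammer (- (c - a - b)) k / fact k) * hypergeom_fps (c - a) (c - b) c
    = hypergeom_fps a b c"
proof (rule hypergeom_fps_unique[OF assms])
  define s where "s = c - a - b"
  define B where "B = Abs_fps (\<lambda>k. pochhammer (- s) k / fact k :: complex)"
  define H where "H = hypergeom_fps (c - a) (c - b) c"
  have B1: "(1 - fps_X) * fps_deriv B = - fps_const s * B"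
  proof (rule fps_ext)
    fix n
    have "(1 - fps_X) * fps_deriv B = fps_deriv B - fps_X * fps_deriv B"
      by (simp add: algebra_simps)
    then show "fps_nth ((1 - fps_X) * fps_deriv B) n = fps_nth (- fps_const s * B) n"
      by (cases n) (simp_all add: B_def pochhammer_Suc divide_simps del: of_nat_Suc,
          simp_all add: algebra_simps)
  qed
  have "fps_deriv ((1 - fps_X) * fps_deriv B) = fps_deriv (- fps_const s * B)"
    by (simp only: B1)
  then have B2: "(1 - fps_X) * fps_deriv (fps_deriv B) = (1 - fps_const s) * fps_deriv B"
    by (simp add: algebra_simps del: fps_const_neg)
  have H: "fps_X * (1 - fps_X) * fps_deriv (fps_deriv H)
     + (fps_const c - (fps_const c - fps_const a + (fps_const c - fps_const b) + 1) * fps_X) * fps_deriv H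
     - (fps_const c - fps_const a) * (fps_const c - fps_const b) * H = 0"
    using hypergeom_ode_hypergeom_fps[OF assms, of "c - a" "c - b"]
    unfolding hypergeom_ode_def H_def fps_const_sub[symmetric] .
  have S: "fps_const s = fps_const c - fps_const a - fps_const b"
    by (simp add: s_def)
  have D: "fps_deriv (B * H) = fps_deriv B * H + B * fps_deriv H"
    "fps_deriv (fps_deriv (B * H)) = fps_deriv (fps_deriv B) * H
       + 2 * fps_deriv B * fps_deriv H + B * fps_deriv (fps_deriv H)"
    by (simp_all only: fps_deriv_mult fps_deriv_add mult_2 distrib_left distrib_right add_ac)
  have "(1 - fps_X) * hypergeom_ode a b c (B * H) = 0"
    unfolding hypergeom_ode_def D(2) unfolding D(1) using B1 B2 H unfolding S by (rule euler_transform_identity)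
  \<comment> \<open>Complex formal power series have no zero divisors, so the factor
    \<open>1 - fps_X\<close> cancels.\<close>
  moreover have "fps_nth (1 - fps_X :: complex fps) 0 \<noteq> fps_nth 0 0"
    by simp
  then have "(1 - fps_X :: complex fps) \<noteq> 0"
    by metis
  ultimately have "hypergeom_ode a b c (B * H) = 0"
    by (simp only: mult_eq_0_iff simp_thms)
  then show "hypergeom_ode a b c (Abs_fps (\<lambda>k. pochhammer (- (c - a - b)) k / fact k)
      * hypergeom_fps (c - a) (c - b) c) = 0"
    unfolding B_def H_def s_def .
qed (simp add: hypergeom_fps_def)

text \<open>In the unit disc both factors are absolutely convergent power series; the formal
  identity gives the coefficients of their Cauchy product.\<close>

lemma is_hyp2F1_euler_transform:
  assumes F: "is_hyp2F1 (c - a) (c - b) c F" and c: "c \<notin> \<int>\<^sub>\<le>\<^sub>0"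
  shows "is_hyp2F1 a b c (\<lambda>z. (1 - z) powr (c - a - b) * F z)"
  unfolding is_hyp2F1_def
proof (intro conjI allI impI)
  show "(\<lambda>z. (1 - z) powr (c - a - b) * F z) holomorphic_on hyp2F1_domain"
    using F hyp2F1_domain_kernel[of _ 1] unfolding is_hyp2F1_def
    by (intro holomorphic_intros) auto
  fix z :: complex assume z: "norm z < 1"
  define p where "p k = pochhammer (- (c - a - b)) k / fact k" for k
  define q where "q k = fps_nth (hypergeom_fps (c - a) (c - b) c) k" for k
  have p: "(\<lambda>k. p k * z ^ k) sums (1 - z) powr (c - a - b)" if "norm z < 1" for z
    using binomial_series_pochhammer[OF that, of "- (c - a - b)"] unfolding p_def by simp
  have q: "(\<lambda>k. q k * z ^ k) sums F z" if "norm z < 1" for z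
    using F that by (simp add: q_def hypergeom_fps_def is_hyp2F1_def)
  obtain r where r: "norm z < r" "r < 1" using dense z by blast
  then have r': "norm (complex_of_real r) < 1" "norm z < norm (complex_of_real r)"
    using le_less_trans[OF norm_ge_zero r(1)] by auto
  have "(\<lambda>k. \<Sum>i\<le>k. (p i * z ^ i) * (q (k - i) * z ^ (k - i))) sums
      ((\<Sum>k. p k * z ^ k) * (\<Sum>k. q k * z ^ k))"
    using powser_insidea[OF sums_summable[OF p[OF r'(1)]] r'(2)]
      powser_insidea[OF sums_summable[OF q[OF r'(1)]] r'(2)]
    by (rule Cauchy_product_sums)
  also have "(\<Sum>k. p k * z ^ k) * (\<Sum>k. q k * z ^ k) = (1 - z) powr (c - a - b) * F z"
    using p[OF z] q[OF z] by (simp add: sums_iff)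
  also have "(\<lambda>k. \<Sum>i\<le>k. (p i * z ^ i) * (q (k - i) * z ^ (k - i))) =
      (\<lambda>k. fps_nth (hypergeom_fps a b c) k * z ^ k)"
  proof
    fix k
    have "(\<Sum>i\<le>k. (p i * z ^ i) * (q (k - i) * z ^ (k - i))) = (\<Sum>i\<le>k. p i * q (k - i) * z ^ k)"
      by (intro sum.cong refl) (simp add: power_diff_power_eq mult_ac flip: power_add)
    also have "\<dots> = fps_nth (hypergeom_fps a b c) k * z ^ k"
      by (simp add: p_def q_def fps_mult_nth atLeast0AtMost sum_distrib_right
          flip: hypergeom_fps_euler_transform[OF c, of a b])
    finally show "(\<Sum>i\<le>k. (p i * z ^ i) * (q (k - i) * z ^ (k - i))) =
        fps_nth (hypergeom_fps a b c) k * z ^ k" .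
  qed
  finally show "(\<lambda>k. pochhammer a k * pochhammer b k / (pochhammer c k * fact k) * z ^ k)
      sums ((1 - z) powr (c - a - b) * F z)"
    by (simp add: hypergeom_fps_def)
qed

text \<open>The condition on \<open>c - b\<close> supplies the continuation for the parameters
  \<open>c - a\<close>, \<open>c - b\<close>. The one for \<open>a\<close>, \<open>b\<close> is
  built from it, so \<open>Re b\<close> is unrestricted.\<close>

lemma hyp2F1_euler_transform:
  assumes "c \<notin> \<int>\<^sub>\<le>\<^sub>0" "Re (c - b) > 0" "z \<in> hyp2F1_domain"
  shows "hyp2F1 a b c z = (1 - z) powr (c - a - b) * hyp2F1 (c - a) (c - b) c z"
  using assms by (intro hyp2F1_eqI is_hyp2F1_euler_transform is_hyp2F1_hyp2F1)

subsection \<open>The fractional integral\<close>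

lemma one_minus_mult_pos: "1 - y * t > 0" if "y < 1" "0 \<le> t" "t \<le> 1" for y t :: real
  using that mult_right_mono[of y 1 t] by (cases "t = 1") auto

text \<open>Put \<open>d = 1 - x * t\<close> and \<open>k = d / t\<close>. The substitution
  \<open>y = x - k * v\<close> gives \<open>x - y = k * v\<close> and
  \<open>1 - y * t = d * (1 + v)\<close>, hence a Beta integral in \<open>v\<close>.\<close>

lemma has_bochner_integral_weyl_kernel:
  assumes "Re \<mu> > 0" "Re \<mu> < Re \<alpha>" "0 < t" "t \<le> 1" "x < 1"
  shows "has_bochner_integral lborel
    (\<lambda>y. indicator {..<x} y *\<^sub>R (complex_of_real (1 - y * t) powr (- \<alpha>) * complex_of_real (x - y) powr (\<mu> - 1)))
    (Gamma \<mu> * Gamma (\<alpha> - \<mu>) / Gamma \<alpha> * (complex_of_real t powr (- \<mu>) * complex_of_real (1 - x * t) powr (- (\<alpha> - \<mu>))))"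
proof -
  define d where "d = 1 - x * t"
  define k where "k = d / t"
  have d: "d > 0"
    unfolding d_def using assms one_minus_mult_pos by auto
  then have k: "k > 0"
    using assms by (simp add: k_def)
  let ?h = "\<lambda>v. indicator {0<..} v *\<^sub>R (complex_of_real v powr (\<mu> - 1) * complex_of_real (1 + v) powr (- \<alpha>))"
  define C where "C = complex_of_real k powr (\<mu> - 1) * complex_of_real d powr (- \<alpha>)"
  have "has_bochner_integral lborel (\<lambda>y. ?h (x / k + (- 1 / k) * y))
      ((Gamma \<mu> * Gamma (\<alpha> - \<mu>) / Gamma \<alpha>) /\<^sub>R \<bar>- 1 / k\<bar>)"
    using has_bochner_integral_Beta[OF assms(1,2)] k
    by (subst (asm) lborel_has_bochner_integral_real_affine_iff[of "- 1 / k" _ _ "x / k"]) simp_all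
  from has_bochner_integral_mult_right[of C, OF this]
  have "has_bochner_integral lborel (\<lambda>y. C * ?h (x / k + (- 1 / k) * y))
      (C * ((Gamma \<mu> * Gamma (\<alpha> - \<mu>) / Gamma \<alpha>) /\<^sub>R \<bar>- 1 / k\<bar>))" .
  also have "(\<lambda>y. C * ?h (x / k + (- 1 / k) * y)) =
      (\<lambda>y. indicator {..<x} y *\<^sub>R (complex_of_real (1 - y * t) powr (- \<alpha>) * complex_of_real (x - y) powr (\<mu> - 1)))"
  proof
    fix y
    have eq: "x / k + (- 1 / k) * y = (x - y) / k"
      by (simp add: diff_divide_distrib)
    show "C * ?h (x / k + (- 1 / k) * y) =
      indicator {..<x} y *\<^sub>R (complex_of_real (1 - y * t) powr (- \<alpha>) * complex_of_real (x - y) powr (\<mu> - 1))"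
    proof (cases "y < x")
      case True
      have "k * ((x - y) / k) = x - y" "(x - y) / k > 0"
        using k True by auto
      then have 1: "complex_of_real (x - y) powr (\<mu> - 1) =
          complex_of_real k powr (\<mu> - 1) * complex_of_real ((x - y) / k) powr (\<mu> - 1)"
        using k powr_of_real_mult[of k "(x - y) / k" "\<mu> - 1"] by simp
      have "d * (1 + (x - y) / k) = 1 - y * t"
        using d assms by (simp add: k_def d_def field_simps)
      then have 2: "complex_of_real (1 - y * t) powr (- \<alpha>) =
          complex_of_real d powr (- \<alpha>) * complex_of_real (1 + (x - y) / k) powr (- \<alpha>)"
        using powr_of_real_mult[of d "1 + (x - y) / k" "- \<alpha>"] d \<open>(x - y) / k > 0\<close> by simp
      show ?thesis
        unfolding eq 1 2 using True \<open>(x - y) / k > 0\<close> by (simp add: C_def mult_ac)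
    next
      case False
      then have "\<not> (x - y) / k > 0"
        using k by (simp add: zero_less_divide_iff)
      then show ?thesis
        unfolding eq using False by (simp add: indicator_def)
    qed
  qed
  also have "C * ((Gamma \<mu> * Gamma (\<alpha> - \<mu>) / Gamma \<alpha>) /\<^sub>R \<bar>- 1 / k\<bar>) =
      Gamma \<mu> * Gamma (\<alpha> - \<mu>) / Gamma \<alpha> * (complex_of_real t powr (- \<mu>) * complex_of_real (1 - x * t) powr (- (\<alpha> - \<mu>)))"
  proof -
    \<comment> \<open>The Jacobian \<open>k\<close> completes \<open>k powr \<mu>\<close>, which
      splits into \<open>d powr \<mu> * t powr (- \<mu>)\<close>.\<close>
    have "complex_of_real k * complex_of_real k powr (\<mu> - 1) = complex_of_real k powr \<mu>"
      using k by (simp add: powr_diff)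
    also have "\<dots> = complex_of_real d powr \<mu> * complex_of_real t powr (- \<mu>)"
      using powr_of_real_mult[of d "inverse t" \<mu>] d assms powr_of_real_pos[of t] powr_of_real_pos[of "inverse t"]
      by (simp add: k_def divide_inverse ln_inverse)
    finally have "of_real k * C = complex_of_real t powr (- \<mu>) * (complex_of_real d powr \<mu> * complex_of_real d powr (- \<alpha>))"
      by (simp add: C_def mult_ac)
    also have "complex_of_real d powr \<mu> * complex_of_real d powr (- \<alpha>) = complex_of_real d powr (- (\<alpha> - \<mu>))"
      by (simp flip: powr_add)
    finally show ?thesis
      using k by (simp add: d_def scaleR_conv_of_real mult_ac)
  qed
  finally show ?thesis .
qed

text \<open>For \<open>\<alpha> = c - a\<close> and \<open>\<beta> = c - b\<close> this is the Gamma
  factor in the theorem.\<close>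

definition weyl_const :: "complex \<Rightarrow> complex \<Rightarrow> complex \<Rightarrow> complex \<Rightarrow> complex" where
  "weyl_const \<alpha> \<beta> c \<mu> = Gamma (\<alpha> - \<mu>) / Gamma \<alpha> * (Gamma (\<beta> - \<mu>) / Gamma \<beta>) * (Gamma c / Gamma (c - \<mu>))"

text \<open>With \<open>t = euler_ratio u\<close>, integrating over \<open>y\<close> first yields
  \<open>t powr (- \<mu>) * (1 - x * t) powr (- (\<alpha> - \<mu>))\<close>. The power of
  \<open>t\<close> shifts the weight to \<open>\<beta> - \<mu>\<close>, \<open>c - \<mu>\<close>, so
  the outer integral is again Euler's; the difference \<open>c - \<beta>\<close> is
  unchanged.\<close>

lemma has_bochner_integral_weyl_euler_integral:
  assumes "Re \<mu> > 0" "Re \<mu> < Re \<alpha>" "Re \<mu> < Re \<beta>" "Re \<beta> < Re c" "x < 1"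
  shows "has_bochner_integral lborel
    (\<lambda>y. indicator {..<x} y *\<^sub>R (euler_integral \<alpha> \<beta> c (of_real y) * complex_of_real (x - y) powr (\<mu> - 1)))
    (Gamma \<mu> * weyl_const \<alpha> \<beta> c \<mu> * euler_integral (\<alpha> - \<mu>) (\<beta> - \<mu>) (c - \<mu>) (of_real x))"
proof -
  define f where "f \<alpha> \<beta> c \<mu> u y = euler_weight \<beta> c u * (indicator {..<x} y *\<^sub>R
      (complex_of_real (1 - y * euler_ratio u) powr (- \<alpha>) * complex_of_real (x - y) powr (\<mu> - 1)))"
    for \<alpha> \<beta> c \<mu> u y
  define g where "g \<alpha> \<beta> c \<mu> u = Gamma \<mu> * Gamma (\<alpha> - \<mu>) / Gamma \<alpha> *
      (euler_weight (\<beta> - \<mu>) (c - \<mu>) u * (1 - of_real x * complex_of_real (euler_ratio u)) powr (- (\<alpha> - \<mu>)))"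
    for \<alpha> \<beta> c \<mu> u
  let ?J = "\<lambda>\<alpha> \<beta> c z. \<integral>u. euler_weight \<beta> c u * (1 - z * complex_of_real (euler_ratio u)) powr (- \<alpha>) \<partial>lborel"
  let ?h = "\<lambda>y. ?J \<alpha> \<beta> c (of_real y) * (indicator {..<x} y *\<^sub>R complex_of_real (x - y) powr (\<mu> - 1))"
  have w: "integrable lborel (euler_weight \<beta> c)" if "Re \<beta> > 0" "Re \<beta> < Re c" for \<beta> c
    using has_bochner_integral_euler_weight[OF that] by (simp add: has_bochner_integral_iff)
  have J: "has_bochner_integral lborel
      (\<lambda>u. euler_weight \<beta> c u * (1 - complex_of_real y * complex_of_real (euler_ratio u)) powr (- \<alpha>))
      (?J \<alpha> \<beta> c (of_real y))" if "Re \<beta> > 0" "Re \<beta> < Re c" "y < 1" for \<alpha> \<beta> c y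
    using integrable_hyp2F1_kernel[OF w[OF that(1,2)] _ euler_ratio_range of_real_in_hyp2F1_domain[OF that(3)]]
    by (simp add: has_bochner_integral_iff)
  have f_int: "has_bochner_integral lborel (f \<alpha> \<beta> c \<mu> u) (g \<alpha> \<beta> c \<mu> u)"
    if "Re \<mu> > 0" "Re \<mu> < Re \<alpha>" for \<alpha> \<beta> c \<mu> u
  proof (cases "u > 0")
    case True
    then have "euler_ratio u > 0" "euler_ratio u \<le> 1"
      using euler_ratio_range[of u] by (auto simp: euler_ratio_def)
    from has_bochner_integral_mult_right[of "euler_weight \<beta> c u",
        OF has_bochner_integral_weyl_kernel[OF that this assms(5)]]
    show ?thesis
      using euler_weight_mult_ratio_powr[OF True, of \<beta> c "- \<mu>"] unfolding f_def g_def
      by (simp add: mult_ac) (simp add: mult.assoc[symmetric])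
  next
    case False
    then have "f \<alpha> \<beta> c \<mu> u = (\<lambda>_. 0)" "g \<alpha> \<beta> c \<mu> u = 0"
      by (auto simp: f_def g_def euler_weight_def fun_eq_iff)
    then show ?thesis by (simp add: has_bochner_integral_zero)
  qed
  have g_int: "has_bochner_integral lborel (g \<alpha> \<beta> c \<mu>)
      (Gamma \<mu> * Gamma (\<alpha> - \<mu>) / Gamma \<alpha> * ?J (\<alpha> - \<mu>) (\<beta> - \<mu>) (c - \<mu>) (of_real x))"
    if "Re \<mu> < Re \<beta>" "Re \<beta> < Re c" for \<alpha> \<beta> c \<mu>
    unfolding g_def using that assms(5) by (intro has_bochner_integral_mult_right J) auto
  have norm_f: "complex_of_real (norm (f \<alpha> \<beta> c \<mu> u y)) = f (Re \<alpha>) (Re \<beta>) (Re c) (Re \<mu>) u y" for u y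
  proof (cases "u > 0 \<and> y < x")
    case True
    have "1 - y * euler_ratio u > 0"
      using euler_ratio_range[of u] True assms(5) by (intro one_minus_mult_pos) auto
    then show ?thesis
      using True powr_of_real[of u "Re \<beta> - 1"] powr_of_real[of "1 + u" "- Re c"]
        powr_of_real[of "1 - y * euler_ratio u" "- Re \<alpha>"] powr_of_real[of "x - y" "Re \<mu> - 1"]
        norm_powr_of_real_pos[of u] norm_powr_of_real_pos[of "1 + u"]
        norm_powr_of_real_pos[of "1 - y * euler_ratio u"] norm_powr_of_real_pos[of "x - y"]
      by (simp add: f_def euler_weight_def norm_mult)
  qed (auto simp: f_def euler_weight_def)
  have "has_bochner_integral lborel ?h
      (Gamma \<mu> * Gamma (\<alpha> - \<mu>) / Gamma \<alpha> * ?J (\<alpha> - \<mu>) (\<beta> - \<mu>) (c - \<mu>) (of_real x))"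
  proof (rule has_bochner_integral_Fubini)
    show "case_prod (f \<alpha> \<beta> c \<mu>) \<in> borel_measurable (lborel \<Otimes>\<^sub>M lborel)"
      unfolding f_def euler_weight_def by measurable
    show "has_bochner_integral lborel (f \<alpha> \<beta> c \<mu> u) (g \<alpha> \<beta> c \<mu> u)" for u
      using f_int assms by blast
    show "has_bochner_integral lborel (\<lambda>y. norm (f \<alpha> \<beta> c \<mu> u y)) (Re (g (Re \<alpha>) (Re \<beta>) (Re c) (Re \<mu>) u))" for u
      using f_int[of "Re \<mu>" "Re \<alpha>" "Re \<beta>" "Re c" u] assms
      by (intro has_bochner_integral_of_real_D) (simp add: norm_f)
    show "integrable lborel (\<lambda>u. Re (g (Re \<alpha>) (Re \<beta>) (Re c) (Re \<mu>) u))"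
      using g_int[of "Re \<mu>" "Re \<beta>" "Re c" "Re \<alpha>"] assms
      by (intro integrable_Re) (simp add: has_bochner_integral_iff)
    show "has_bochner_integral lborel (g \<alpha> \<beta> c \<mu>)
      (Gamma \<mu> * Gamma (\<alpha> - \<mu>) / Gamma \<alpha> * ?J (\<alpha> - \<mu>) (\<beta> - \<mu>) (c - \<mu>) (of_real x))"
      using g_int assms by blast
    show "has_bochner_integral lborel (\<lambda>u. f \<alpha> \<beta> c \<mu> u y) (?h y)" for y
    proof (cases "y < x")
      case True
      with has_bochner_integral_mult_left[of "complex_of_real (x - y) powr (\<mu> - 1)", OF J[of \<beta> c y \<alpha>]] assms
      show ?thesis
        by (simp add: f_def mult_ac)
    next
      case False
      then have "(\<lambda>u. f \<alpha> \<beta> c \<mu> u y) = (\<lambda>_. 0)"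
        by (auto simp: f_def)
      with False show ?thesis by (simp add: has_bochner_integral_zero)
    qed
  qed
  from has_bochner_integral_mult_right[of "Gamma c / (Gamma \<beta> * Gamma (c - \<beta>))", OF this]
  have "has_bochner_integral lborel (\<lambda>y. Gamma c / (Gamma \<beta> * Gamma (c - \<beta>)) * ?h y)
    (Gamma c / (Gamma \<beta> * Gamma (c - \<beta>)) *
      (Gamma \<mu> * Gamma (\<alpha> - \<mu>) / Gamma \<alpha> * ?J (\<alpha> - \<mu>) (\<beta> - \<mu>) (c - \<mu>) (of_real x)))" .
  \<comment> \<open>These Gamma values enter through the normalisation of the Euler integral on the
    right and cancel against \<open>weyl_const\<close>.\<close>
  moreover have "Gamma (c - \<mu>) \<noteq> 0" "Gamma (\<beta> - \<mu>) \<noteq> 0"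
    using assms by (auto simp: Gamma_eq_zero_iff intro!: not_nonpos_Ints_Re_pos)
  ultimately show ?thesis
    by (simp add: euler_integral_def weyl_const_def mult_ac)
qed

text \<open>Induction on a bound for \<open>Re \<beta> - Re c\<close>. The contiguous relation
  reduces the integral to three instances in which \<open>Re c - Re \<beta>\<close> is larger by 1;
  \<open>\<mu>\<close> is generalised too, as one instance has \<open>\<mu> + 1\<close>.\<close>

lemma has_bochner_integral_weyl_hyp2F1:
  assumes "Re \<mu> > 0" "Re \<mu> < Re \<alpha>" "Re \<mu> < Re \<beta>" "c \<notin> \<int>\<^sub>\<le>\<^sub>0" "c - \<mu> \<notin> \<int>\<^sub>\<le>\<^sub>0" "x < 1"
  shows "has_bochner_integral lborel
    (\<lambda>y. indicator {..<x} y *\<^sub>R (hyp2F1 \<alpha> \<beta> c (of_real y) * complex_of_real (x - y) powr (\<mu> - 1)))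
    (Gamma \<mu> * weyl_const \<alpha> \<beta> c \<mu> * hyp2F1 (\<alpha> - \<mu>) (\<beta> - \<mu>) (c - \<mu>) (of_real x))"
proof -
  have "has_bochner_integral lborel
      (\<lambda>y. indicator {..<x} y *\<^sub>R (hyp2F1 \<alpha> \<beta> c (of_real y) * complex_of_real (x - y) powr (\<mu> - 1)))
      (Gamma \<mu> * weyl_const \<alpha> \<beta> c \<mu> * hyp2F1 (\<alpha> - \<mu>) (\<beta> - \<mu>) (c - \<mu>) (of_real x))"
    if "Re \<mu> > 0" "Re \<mu> < Re \<alpha>" "Re \<mu> < Re \<beta>" "c \<notin> \<int>\<^sub>\<le>\<^sub>0" "c - \<mu> \<notin> \<int>\<^sub>\<le>\<^sub>0"
      "Re c + real n > Re \<beta>" for n \<alpha> \<beta> c \<mu>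
    using that
  proof (induction n arbitrary: \<alpha> \<beta> c \<mu>)
    case 0
    have "hyp2F1 \<alpha> \<beta> c (of_real y) = euler_integral \<alpha> \<beta> c (of_real y)" if "y < x" for y
      using 0 assms(6) that by (intro hyp2F1_eqI is_hyp2F1_euler_integral of_real_in_hyp2F1_domain) auto
    then have "(\<lambda>y. indicator {..<x} y *\<^sub>R (hyp2F1 \<alpha> \<beta> c (of_real y) * complex_of_real (x - y) powr (\<mu> - 1))) =
        (\<lambda>y. indicator {..<x} y *\<^sub>R (euler_integral \<alpha> \<beta> c (of_real y) * complex_of_real (x - y) powr (\<mu> - 1)))"
      by (auto simp: fun_eq_iff indicator_def)
    moreover have "hyp2F1 (\<alpha> - \<mu>) (\<beta> - \<mu>) (c - \<mu>) (of_real x) = euler_integral (\<alpha> - \<mu>) (\<beta> - \<mu>) (c - \<mu>) (of_real x)"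
      using 0 assms(6) by (intro hyp2F1_eqI is_hyp2F1_euler_integral of_real_in_hyp2F1_domain) auto
    ultimately show ?case
      using has_bochner_integral_weyl_euler_integral[of \<mu> \<alpha> \<beta> c x] 0 assms(6) by simp
  next
    case (Suc n)
    note prems = Suc.prems
    have c1: "c + 1 \<notin> \<int>\<^sub>\<le>\<^sub>0" "c + 2 \<notin> \<int>\<^sub>\<le>\<^sub>0" "c - \<mu> + 1 \<notin> \<int>\<^sub>\<le>\<^sub>0" "c - \<mu> + 2 \<notin> \<int>\<^sub>\<le>\<^sub>0"
      using not_nonpos_Ints_plus1[OF prems(4)] not_nonpos_Ints_plus1[of "c + 1"]
        not_nonpos_Ints_plus1[OF prems(5)] not_nonpos_Ints_plus1[of "c - \<mu> + 1"]
      by (simp_all add: add.assoc)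
    have c0: "c \<noteq> 0" "c + 1 \<noteq> 0" "c - \<mu> \<noteq> 0" "c - \<mu> + 1 \<noteq> 0"
      using prems(4,5) c1 by auto
    have ab: "\<alpha> \<notin> \<int>\<^sub>\<le>\<^sub>0" "\<beta> \<notin> \<int>\<^sub>\<le>\<^sub>0" "\<alpha> - \<mu> \<notin> \<int>\<^sub>\<le>\<^sub>0" "\<beta> - \<mu> \<notin> \<int>\<^sub>\<le>\<^sub>0" "\<mu> \<notin> \<int>\<^sub>\<le>\<^sub>0"
      using prems by (auto intro!: not_nonpos_Ints_Re_pos)
    define \<Phi>1 where "\<Phi>1 = hyp2F1 (\<alpha> - \<mu>) (\<beta> - \<mu>) (c - \<mu> + 1) (of_real x)"
    define \<Phi>2 where "\<Phi>2 = hyp2F1 (\<alpha> - \<mu> + 1) (\<beta> - \<mu> + 1) (c - \<mu> + 2) (of_real x)"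
    define \<kappa> where "\<kappa> = \<alpha> * \<beta> / (c * (c + 1))"
    let ?W = "\<lambda>\<alpha> \<beta> c \<mu> y. indicator {..<x} y *\<^sub>R (hyp2F1 \<alpha> \<beta> c (of_real y) * complex_of_real (x - y) powr (\<mu> - 1))"
    have eqs: "c + 1 - \<mu> = c - \<mu> + 1" "\<alpha> + 1 - \<mu> = \<alpha> - \<mu> + 1" "\<beta> + 1 - \<mu> = \<beta> - \<mu> + 1" "c + 2 - \<mu> = c - \<mu> + 2"
      "\<alpha> + 1 - (\<mu> + 1) = \<alpha> - \<mu>" "\<beta> + 1 - (\<mu> + 1) = \<beta> - \<mu>" "c + 2 - (\<mu> + 1) = c - \<mu> + 1"
      by simp_all
    have 1: "has_bochner_integral lborel (?W \<alpha> \<beta> (c + 1) \<mu>) (Gamma \<mu> * weyl_const \<alpha> \<beta> (c + 1) \<mu> * \<Phi>1)"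
      using Suc.IH[of \<mu> \<alpha> \<beta> "c + 1"] prems c1 by (simp add: \<Phi>1_def eqs)
    have 2: "has_bochner_integral lborel (?W (\<alpha> + 1) (\<beta> + 1) (c + 2) \<mu>)
        (Gamma \<mu> * weyl_const (\<alpha> + 1) (\<beta> + 1) (c + 2) \<mu> * \<Phi>2)"
      using Suc.IH[of \<mu> "\<alpha> + 1" "\<beta> + 1" "c + 2"] prems c1 by (simp add: \<Phi>2_def eqs)
    \<comment> \<open>Raising \<open>\<mu>\<close> as well brings the parameters on the right back
      to \<open>\<alpha> - \<mu>\<close>, \<open>\<beta> - \<mu>\<close>,
      \<open>c - \<mu> + 1\<close>, so \<open>\<Phi>1\<close> appears again.\<close>
    have 3: "has_bochner_integral lborel (?W (\<alpha> + 1) (\<beta> + 1) (c + 2) (\<mu> + 1))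
        (Gamma (\<mu> + 1) * weyl_const (\<alpha> + 1) (\<beta> + 1) (c + 2) (\<mu> + 1) * \<Phi>1)"
      using Suc.IH[of "\<mu> + 1" "\<alpha> + 1" "\<beta> + 1" "c + 2"] prems c1 unfolding \<Phi>1_def eqs by simp
    have "has_bochner_integral lborel
        (\<lambda>y. ?W \<alpha> \<beta> (c + 1) \<mu> y + \<kappa> * of_real x * ?W (\<alpha> + 1) (\<beta> + 1) (c + 2) \<mu> y
             - \<kappa> * ?W (\<alpha> + 1) (\<beta> + 1) (c + 2) (\<mu> + 1) y)
        (Gamma \<mu> * weyl_const \<alpha> \<beta> (c + 1) \<mu> * \<Phi>1
          + \<kappa> * of_real x * (Gamma \<mu> * weyl_const (\<alpha> + 1) (\<beta> + 1) (c + 2) \<mu> * \<Phi>2)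
          - \<kappa> * (Gamma (\<mu> + 1) * weyl_const (\<alpha> + 1) (\<beta> + 1) (c + 2) (\<mu> + 1) * \<Phi>1))"
      using 1 2 3
      by (intro has_bochner_integral_diff has_bochner_integral_add has_bochner_integral_mult_right)
    \<comment> \<open>In the contiguous relation, write \<open>y = x - (x - y)\<close>: the second term raises \<open>\<mu>\<close> by one.\<close>
    also have "(\<lambda>y. ?W \<alpha> \<beta> (c + 1) \<mu> y + \<kappa> * of_real x * ?W (\<alpha> + 1) (\<beta> + 1) (c + 2) \<mu> y
             - \<kappa> * ?W (\<alpha> + 1) (\<beta> + 1) (c + 2) (\<mu> + 1) y) = ?W \<alpha> \<beta> c \<mu>"
    proof
      fix y
      show "?W \<alpha> \<beta> (c + 1) \<mu> y + \<kappa> * of_real x * ?W (\<alpha> + 1) (\<beta> + 1) (c + 2) \<mu> y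
             - \<kappa> * ?W (\<alpha> + 1) (\<beta> + 1) (c + 2) (\<mu> + 1) y = ?W \<alpha> \<beta> c \<mu> y"
      proof (cases "y < x")
        case True
        have powr: "(complex_of_real x - of_real y) powr \<mu> =
            (of_real x - of_real y) * (complex_of_real x - of_real y) powr (\<mu> - 1)"
          using True by (simp add: powr_diff)
        have contiguous: "hyp2F1 \<alpha> \<beta> c (of_real y) = hyp2F1 \<alpha> \<beta> (c + 1) (of_real y)
            + \<kappa> * of_real y * hyp2F1 (\<alpha> + 1) (\<beta> + 1) (c + 2) (of_real y)"
          unfolding \<kappa>_def using True prems assms(6)
          by (intro hyp2F1_contiguous of_real_in_hyp2F1_domain) auto
        show ?thesis
          unfolding contiguous using True by (simp add: powr algebra_simps)
      qed simp
    qed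
    also have "Gamma \<mu> * weyl_const \<alpha> \<beta> (c + 1) \<mu> * \<Phi>1
          + \<kappa> * of_real x * (Gamma \<mu> * weyl_const (\<alpha> + 1) (\<beta> + 1) (c + 2) \<mu> * \<Phi>2)
          - \<kappa> * (Gamma (\<mu> + 1) * weyl_const (\<alpha> + 1) (\<beta> + 1) (c + 2) (\<mu> + 1) * \<Phi>1)
        = Gamma \<mu> * weyl_const \<alpha> \<beta> c \<mu> * hyp2F1 (\<alpha> - \<mu>) (\<beta> - \<mu>) (c - \<mu>) (of_real x)"
    proof -
      have G2: "Gamma (z + 2) = (z + 1) * (z * Gamma z)" if "z \<notin> \<int>\<^sub>\<le>\<^sub>0" for z :: complex
        using Gamma_plus1[OF that] Gamma_plus1[OF not_nonpos_Ints_plus1[OF that]] by (simp add: add.assoc)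
      have nz: "\<alpha> \<noteq> 0" "\<beta> \<noteq> 0"
        using ab by auto
      \<comment> \<open>All three constants are multiples of
        \<open>weyl_const \<alpha> \<beta> c \<mu>\<close>: in \<open>k2\<close> and
        \<open>k3\<close> the factors of \<open>\<alpha> * \<beta>\<close> and
        \<open>c * (c + 1)\<close> created by the shifts cancel against
        \<open>\<kappa>\<close>.\<close>
      have k1: "weyl_const \<alpha> \<beta> (c + 1) \<mu> = c / (c - \<mu>) * weyl_const \<alpha> \<beta> c \<mu>"
        unfolding weyl_const_def eqs by (simp add: Gamma_plus1 prems mult_ac)
      have k2: "\<kappa> * weyl_const (\<alpha> + 1) (\<beta> + 1) (c + 2) \<mu> =
          (\<alpha> - \<mu>) * (\<beta> - \<mu>) / ((c - \<mu>) * (c - \<mu> + 1)) * weyl_const \<alpha> \<beta> c \<mu>"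
        unfolding weyl_const_def \<kappa>_def eqs using c0 nz by (simp add: Gamma_plus1 G2 prems ab mult_ac)
      have k3: "\<kappa> * weyl_const (\<alpha> + 1) (\<beta> + 1) (c + 2) (\<mu> + 1) = 1 / (c - \<mu>) * weyl_const \<alpha> \<beta> c \<mu>"
        unfolding weyl_const_def \<kappa>_def eqs using c0 nz by (simp add: Gamma_plus1 G2 prems ab mult_ac)
      have "hyp2F1 (\<alpha> - \<mu>) (\<beta> - \<mu>) (c - \<mu>) (of_real x) =
          \<Phi>1 + (\<alpha> - \<mu>) * (\<beta> - \<mu>) / ((c - \<mu>) * (c - \<mu> + 1)) * of_real x * \<Phi>2"
        unfolding \<Phi>1_def \<Phi>2_def using prems assms(6)
        by (intro hyp2F1_contiguous of_real_in_hyp2F1_domain) auto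
      moreover have "Gamma \<mu> * weyl_const \<alpha> \<beta> (c + 1) \<mu> * \<Phi>1
          + \<kappa> * of_real x * (Gamma \<mu> * weyl_const (\<alpha> + 1) (\<beta> + 1) (c + 2) \<mu> * \<Phi>2)
          - \<kappa> * (Gamma (\<mu> + 1) * weyl_const (\<alpha> + 1) (\<beta> + 1) (c + 2) (\<mu> + 1) * \<Phi>1) =
          Gamma \<mu> * (weyl_const \<alpha> \<beta> (c + 1) \<mu> * \<Phi>1
          + of_real x * (\<kappa> * weyl_const (\<alpha> + 1) (\<beta> + 1) (c + 2) \<mu>) * \<Phi>2
          - \<mu> * (\<kappa> * weyl_const (\<alpha> + 1) (\<beta> + 1) (c + 2) (\<mu> + 1)) * \<Phi>1)"
        unfolding Gamma_plus1[OF ab(5)] by (simp add: algebra_simps)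
      moreover have "\<dots> = Gamma \<mu> * weyl_const \<alpha> \<beta> c \<mu> * ((c / (c - \<mu>) - \<mu> / (c - \<mu>)) * \<Phi>1
          + (\<alpha> - \<mu>) * (\<beta> - \<mu>) / ((c - \<mu>) * (c - \<mu> + 1)) * of_real x * \<Phi>2)"
        unfolding k1 k2 k3 by (simp add: left_diff_distrib distrib_left right_diff_distrib mult_ac)
      \<comment> \<open>The two contributions of \<open>\<Phi>1\<close> thus have total coefficient
        1, which leaves the contiguous relation at \<open>c - \<mu>\<close>.\<close>
      moreover have "c / (c - \<mu>) - \<mu> / (c - \<mu>) = 1"
        using c0 by (simp flip: diff_divide_distrib)
      ultimately show ?thesis by simp
    qed
    finally show ?case .
  qed
  moreover obtain n where "Re \<beta> - Re c < real n"
    using reals_Archimedean2 by blast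
  ultimately show ?thesis
    using assms by (simp add: algebra_simps)
qed

theorem mainTheorem5:
  fixes a b c \<mu> :: complex and x :: real
  assumes "c \<notin> \<int>\<^sub>\<le>\<^sub>0" and "c - \<mu> \<notin> \<int>\<^sub>\<le>\<^sub>0"
    and "Re \<mu> > 0"
    and "Re (c - a) > Re \<mu>" and "Re (c - b) > Re \<mu>"
    and "x < 1"
  shows "set_integrable lborel {..<x}
           (\<lambda>y. complex_of_real (1 - y) powr (a + b - c) * hyp2F1 a b c (complex_of_real y)
                * (complex_of_real (x - y) powr (\<mu> - 1) / Gamma \<mu>)) \<and>
         (LBINT y:{..<x}. complex_of_real (1 - y) powr (a + b - c) * hyp2F1 a b c (complex_of_real y)
                * (complex_of_real (x - y) powr (\<mu> - 1) / Gamma \<mu>))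
         = Gamma (c - a - \<mu>) / Gamma (c - a) * (Gamma (c - b - \<mu>) / Gamma (c - b))
           * (Gamma c / Gamma (c - \<mu>))
           * complex_of_real (1 - x) powr (a + b - c + \<mu>) * hyp2F1 a b (c - \<mu>) (complex_of_real x)"
proof -
  \<comment> \<open>The lower parameter is left free: the identity is used at \<open>c\<close> under
    the integral and at \<open>c - \<mu>\<close> on the right, where the exponent is
    \<open>a + b - (c - \<mu>)\<close>.\<close>
  have euler: "complex_of_real (1 - y) powr (a + b - c) * hyp2F1 a b c (complex_of_real y) =
      hyp2F1 (c - a) (c - b) c (complex_of_real y)"
    if "c \<notin> \<int>\<^sub>\<le>\<^sub>0" "Re (c - b) > 0" "y < 1" for c y
  proof -
    have "complex_of_real (1 - y) powr (a + b - c) * (1 - complex_of_real y) powr (c - a - b) = 1"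
      using that(3) by (simp flip: powr_add)
    then show ?thesis
      using hyp2F1_euler_transform[OF that(1,2) of_real_in_hyp2F1_domain[OF that(3)], of a]
      by (simp add: mult.assoc[symmetric])
  qed
  have \<mu>: "Gamma \<mu> \<noteq> 0"
    using assms by (auto simp: Gamma_eq_zero_iff intro!: not_nonpos_Ints_Re_pos)
  have "has_bochner_integral lborel
      (\<lambda>y. 1 / Gamma \<mu> * (indicator {..<x} y *\<^sub>R (hyp2F1 (c - a) (c - b) c (of_real y) * complex_of_real (x - y) powr (\<mu> - 1))))
      (1 / Gamma \<mu> * (Gamma \<mu> * weyl_const (c - a) (c - b) c \<mu> * hyp2F1 (c - a - \<mu>) (c - b - \<mu>) (c - \<mu>) (of_real x)))"
    using assms by (intro has_bochner_integral_mult_right has_bochner_integral_weyl_hyp2F1) auto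
  also have "(\<lambda>y. 1 / Gamma \<mu> * (indicator {..<x} y *\<^sub>R (hyp2F1 (c - a) (c - b) c (of_real y) * complex_of_real (x - y) powr (\<mu> - 1)))) =
      (\<lambda>y. indicator {..<x} y *\<^sub>R (complex_of_real (1 - y) powr (a + b - c) * hyp2F1 a b c (complex_of_real y)
                * (complex_of_real (x - y) powr (\<mu> - 1) / Gamma \<mu>)))"
  proof
    fix y
    show "1 / Gamma \<mu> * (indicator {..<x} y *\<^sub>R (hyp2F1 (c - a) (c - b) c (of_real y) * complex_of_real (x - y) powr (\<mu> - 1))) =
        indicator {..<x} y *\<^sub>R (complex_of_real (1 - y) powr (a + b - c) * hyp2F1 a b c (complex_of_real y)
                * (complex_of_real (x - y) powr (\<mu> - 1) / Gamma \<mu>))"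
      using euler[of c y] assms by (cases "y < x") (simp_all add: mult_ac)
  qed
  also have "1 / Gamma \<mu> * (Gamma \<mu> * weyl_const (c - a) (c - b) c \<mu> * hyp2F1 (c - a - \<mu>) (c - b - \<mu>) (c - \<mu>) (of_real x)) =
      Gamma (c - a - \<mu>) / Gamma (c - a) * (Gamma (c - b - \<mu>) / Gamma (c - b))
           * (Gamma c / Gamma (c - \<mu>))
           * complex_of_real (1 - x) powr (a + b - c + \<mu>) * hyp2F1 a b (c - \<mu>) (complex_of_real x)"
  proof -
    have eqs: "a + b - c + \<mu> = a + b - (c - \<mu>)" "c - a - \<mu> = c - \<mu> - a" "c - b - \<mu> = c - \<mu> - b"
      by simp_all
    show ?thesis
      unfolding weyl_const_def eqs using euler[of "c - \<mu>" x] assms \<mu> by (simp add: mult.assoc)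
  qed
  finally show ?thesis
    unfolding set_integrable_def set_lebesgue_integral_def has_bochner_integral_iff .
qed

end
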